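(* Suppose $G=G^*\cup K_1$, where $G^*$ is a connected graph, and let $n\ge |G|$. (i) If $|G^*|\ge 4$, then there is $n_0(G^* )$ such that for all $n\ge n_0(G^* )$ we have $\mathrm{st}(n,G)=\mathrm{ex}(n,G^* )$. (ii) If $G^*=K_2$, then $\mathrm{st}(n,K_2\cup K_1)=\mathrm{ex}(n,P_3)=\lfloor n/2\rfloor$. (iii) If $G^*=P_3$, then $\mathrm{st}(n,P_3\cup K_1)=\lfloor 2n/3\rfloor$. (iv) If $G^*=K_3$, then $\mathrm{st}(n,K_3\cup K_1)=\mathrm{ex}(n,K_4-P_3)=\mathrm{ex}(n,K_3)=\lfloor n^2/4\rfloor$.
   Context: Graphs are finite and simple; $|G|$ is the number of vertices of $G$; $\cup$ denotes vertex-disjoint union. $P_3$ is the path on 3 vertices; $K_4-P_3$ is the 4-vertex graph obtained from $K_4$ by deleting the two edges of a $P_3$ (a triangle with a pendant edge). $\mathrm{ex}(n,G)$ is the maximum number of edges of a graph on $n$ vertices containing no (not necessarily induced) copy of $G$. For a non-complete graph $G$ on $k$ vertices and $n\ge k$, $\mathrm{st}(n,G)$ is the largest $m$ for which there is a graph $H$ with $n$ vertices and $m$ edges such that no subgraph $F\subseteq H$ on exactly $k$ vertices contains $G$ as a proper subgraph. *)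

theory Defs
  imports Main
begin

type_synonym 'a ugraph = "'a set \<times> 'a set set"

abbreviation vertices :: "'a ugraph \<Rightarrow> 'a set" where
  "vertices \<equiv> fst"

abbreviation edges :: "'a ugraph \<Rightarrow> 'a set set" where
  "edges \<equiv> snd"

definition simple_graph :: "'a ugraph \<Rightarrow> bool" where
  "simple_graph G \<longleftrightarrow>
     finite (vertices G) \<and> (\<forall>e\<in>edges G. e \<subseteq> vertices G \<and> card e = 2)"

definition graph_order :: "'a ugraph \<Rightarrow> nat" where
  "graph_order G = card (vertices G)"

definition graph_size :: "'a ugraph \<Rightarrow> nat" where
  "graph_size G = card (edges G)"

definition connected_graph :: "'a ugraph \<Rightarrow> bool" where
  "connected_graph G \<longleftrightarrow> vertices G \<noteq> {} \<and>
     (\<forall>u\<in>vertices G. \<forall>v\<in>vertices G. (u, v) \<in> {(x, y). {x, y} \<in> edges G}\<^sup>*)"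

definition is_subgraph :: "'a ugraph \<Rightarrow> 'a ugraph \<Rightarrow> bool" (infix "\<subseteq>\<^sub>g" 50) where
  "F \<subseteq>\<^sub>g H \<longleftrightarrow> simple_graph F \<and> simple_graph H \<and>
     vertices F \<subseteq> vertices H \<and> edges F \<subseteq> edges H"

definition graph_iso :: "'a ugraph \<Rightarrow> 'b ugraph \<Rightarrow> bool" (infix "\<simeq>\<^sub>g" 50) where
  "G \<simeq>\<^sub>g H \<longleftrightarrow>
     (\<exists>f. bij_betw f (vertices G) (vertices H) \<and> edges H = (\<lambda>e. f ` e) ` edges G)"

definition contains_copy :: "'a ugraph \<Rightarrow> 'b ugraph \<Rightarrow> bool" where
  "contains_copy H G \<longleftrightarrow> (\<exists>F. F \<subseteq>\<^sub>g H \<and> G \<simeq>\<^sub>g F)"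

definition contains_proper_copy :: "'a ugraph \<Rightarrow> 'b ugraph \<Rightarrow> bool" where
  "contains_proper_copy H G \<longleftrightarrow> (\<exists>F. F \<subseteq>\<^sub>g H \<and> F \<noteq> H \<and> G \<simeq>\<^sub>g F)"

definition disj_union :: "'a ugraph \<Rightarrow> 'b ugraph \<Rightarrow> ('a + 'b) ugraph" (infixl "\<union>\<^sub>g" 65) where
  "G \<union>\<^sub>g H = (Inl ` vertices G \<union> Inr ` vertices H,
               (\<lambda>e. Inl ` e) ` edges G \<union> (\<lambda>e. Inr ` e) ` edges H)"

definition complete_graph :: "nat \<Rightarrow> nat ugraph" where
  "complete_graph n = ({..<n}, {e. e \<subseteq> {..<n} \<and> card e = 2})"

text \<open>The path on \<open>n\<close> vertices (not \<open>n\<close> edges).\<close>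

definition path_graph :: "nat \<Rightarrow> nat ugraph" where
  "path_graph n = ({..<n}, {{i, Suc i} | i. Suc i < n})"

definition delete_edges :: "'a ugraph \<Rightarrow> 'a ugraph \<Rightarrow> 'a ugraph" where
  "delete_edges G F = (vertices G, edges G - edges F)"

text \<open>
  Every finite graph is isomorphic to one whose vertices are natural numbers, so in the two
  extremal numbers below it suffices to let the host graph \<open>H\<close> range over such graphs.
  If no admissible \<open>H\<close> exists, the value is unspecified; this never happens for \<open>ex_num n G\<close>
  when \<open>G\<close> has an edge, nor for \<open>st_num n G\<close> (take \<open>H\<close> without edges).
\<close>

definition ex_num :: "nat \<Rightarrow> 'b ugraph \<Rightarrow> nat" where
  "ex_num n G = (GREATEST m. \<exists>H :: nat ugraph. simple_graph H \<and>
     graph_order H = n \<and> graph_size H = m \<and> \<not> contains_copy H G)"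

text \<open>
  The subgraphs \<open>F\<close> are not required to be induced. The notion is intended for non-complete
  \<open>G\<close> and \<open>n \<ge> graph_order G\<close>.
\<close>

definition st_num :: "nat \<Rightarrow> 'b ugraph \<Rightarrow> nat" where
  "st_num n G = (GREATEST m. \<exists>H :: nat ugraph. simple_graph H \<and>
     graph_order H = n \<and> graph_size H = m \<and>
     \<not> (\<exists>F. F \<subseteq>\<^sub>g H \<and> graph_order F = graph_order G \<and> contains_proper_copy F G))"

end

theory Submission
  imports Defs
begin

text \<open>
  Let \<open>G = Gs \<union> K\<^sub>1\<close> with \<open>Gs\<close> connected of order \<open>s\<close>, and let \<open>H\<close> be a host of order \<open>n > s\<close>. A subgraph
  of order \<open>s + 1\<close> contains \<open>G\<close> properly iff it consists of a copy of \<open>Gs\<close>, one further vertex and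
  at least one further edge among these vertices. So \<open>H\<close> is admissible for \<open>st_num\<close> iff every edge of \<open>H\<close> that meets
  a copy of \<open>Gs\<close> belongs to this copy (\<open>st_admissible_iff\<close>): the copies of \<open>Gs\<close> are components of
  \<open>H\<close>, isomorphic to \<open>Gs\<close>. In particular every graph without a copy of \<open>Gs\<close> is admissible, and
  in each part the question is what the component copies can contribute.

  If \<open>Gs\<close> is a single edge, admissible means being a matching, that is, having no \<open>P\<^sub>3\<close>. If \<open>Gs\<close> is
  \<open>P\<^sub>3\<close>, removing the components one by one gives at most two edges per three vertices
  (\<open>isolates_P3_size\<close>). If \<open>Gs\<close> is a triangle, the admissible hosts are those without a triangle
  plus pendant edge (\<open>contains_paw_iff\<close>), and they have at most \<open>n\<^sup>2 div 4\<close> edges for \<open>n \<noteq> 3\<close>, by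
  removing triangles and Mantel's theorem.

  If \<open>s \<ge> 4\<close> and \<open>n \<ge> 8 * s\<close>, every admissible \<open>H\<close> can be turned into a graph on the same vertices
  without a copy of \<open>Gs\<close> and with no fewer edges (\<open>free_graph_at_least_as_large\<close>). Let \<open>U\<close> be the union
  of the \<open>t\<close> component copies. Since \<open>Gs\<close> is connected, the part on \<open>U\<close> may be exchanged for any
  graph on \<open>U\<close> without a copy of \<open>Gs\<close> (\<open>free_replacement\<close>). Let \<open>d\<close> be the minimum degree of \<open>Gs\<close>,
  attained at \<open>w\<close>. A complete graph on \<open>s - 1\<close> vertices together with one vertex of degree \<open>d - 1\<close>
  contains no copy of \<open>Gs\<close>. If it has at least as many edges as \<open>Gs\<close>, it replaces every copy. Otherwise
  \<open>Gs\<close> has exactly one edge more and \<open>Gs - w\<close> is complete (\<open>sparse_or_near_clique\<close>), so \<open>Gs\<close> contains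
  a triangle, and:

  \<^item> If \<open>t \<ge> 2\<close>, a balanced complete bipartite graph on \<open>U\<close> is large enough.

  \<^item> If \<open>t = 1\<close> and \<open>d \<ge> 2\<close>, the lost edge is regained by a bridge from \<open>U\<close> to the remaining
    vertices. The bridge lies in no copy of \<open>Gs\<close>, because every edge of \<open>Gs\<close> lies in a triangle.

  \<^item> If \<open>t = 1\<close> and \<open>d = 1\<close>, consider \<open>H - U\<close>. A clique on \<open>s - 1\<close> vertices in it is a
    component, which together with \<open>U\<close> is outweighed by a balanced bipartite graph. If there is no such clique but a vertex \<open>v\<close>
    of degree at least \<open>s\<close>, the vertices of \<open>U\<close> become twins of \<open>v\<close>. If all degrees are small, so is
    the number of edges of \<open>H\<close>, and a balanced bipartite graph on all vertices is at least as large.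
\<close>

section \<open>Embeddings and admissible hosts\<close>

text \<open>An embedding maps \<open>G\<close> injectively onto a (not necessarily induced) copy inside \<open>H\<close>.\<close>

definition embeds :: "('a \<Rightarrow> 'b) \<Rightarrow> 'a ugraph \<Rightarrow> 'b ugraph \<Rightarrow> bool" where
  "embeds f G H \<longleftrightarrow> inj_on f (vertices G) \<and> f ` vertices G \<subseteq> vertices H \<and>
     (\<forall>e\<in>edges G. f ` e \<in> edges H)"

text \<open>
  Every edge of \<open>H\<close> meeting a copy of \<open>G\<close> is an edge of this copy. For connected \<open>G\<close> this says that
  each copy of \<open>G\<close> is an entire component of \<open>H\<close>.
\<close>

definition isolates_copies :: "'b ugraph \<Rightarrow> 'a ugraph \<Rightarrow> bool" where
  "isolates_copies H G \<longleftrightarrow> (\<forall>f. embeds f G H \<longrightarrow>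
     (\<forall>e\<in>edges H. e \<inter> f ` vertices G \<noteq> {} \<longrightarrow> e \<in> (\<lambda>e. f ` e) ` edges G))"

text \<open>The condition on host graphs in the definition of \<open>st_num\<close>.\<close>

definition st_admissible :: "'b ugraph \<Rightarrow> 'a ugraph \<Rightarrow> bool" where
  "st_admissible H G \<longleftrightarrow>
     \<not> (\<exists>F. F \<subseteq>\<^sub>g H \<and> graph_order F = graph_order G \<and> contains_proper_copy F G)"

lemma simple_graph_image:
  assumes "simple_graph G" "inj_on f (vertices G)"
  shows "simple_graph (f ` vertices G, (\<lambda>e. f ` e) ` edges G)"
  using assms unfolding simple_graph_def
  by (auto simp: card_image[OF inj_on_subset])

lemma contains_copy_iff:
  assumes "simple_graph G" "simple_graph H"
  shows "contains_copy H G \<longleftrightarrow> (\<exists>f. embeds f G H)"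
proof
  assume "contains_copy H G"
  then obtain F g where F: "F \<subseteq>\<^sub>g H" "bij_betw g (vertices G) (vertices F)"
    "edges F = (\<lambda>e. g ` e) ` edges G"
    unfolding contains_copy_def graph_iso_def by blast
  then have "embeds g G H"
    unfolding embeds_def is_subgraph_def bij_betw_def by auto
  then show "\<exists>f. embeds f G H" by blast
next
  assume "\<exists>f. embeds f G H"
  then obtain f where f: "embeds f G H" by blast
  let ?F = "(f ` vertices G, (\<lambda>e. f ` e) ` edges G)"
  have "?F \<subseteq>\<^sub>g H"
    using f assms simple_graph_image[OF assms(1), of f] unfolding is_subgraph_def embeds_def by auto
  moreover have "G \<simeq>\<^sub>g ?F"
    using f unfolding graph_iso_def embeds_def bij_betw_def by auto
  ultimately show "contains_copy H G" unfolding contains_copy_def by blast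
qed

lemma card_2_two_points:
  assumes "card e = 2" "x \<in> e"
  obtains y where "e = {x, y}" "y \<noteq> x"
  using assms by (metis card_2_iff doubleton_eq_iff insertE singletonD)

lemma edge_other_end:
  assumes "simple_graph H" "e \<in> edges H" "x \<in> e"
  obtains y where "e = {x, y}" "y \<noteq> x"
  using assms card_2_two_points unfolding simple_graph_def by metis

lemma graph_order_union_K1:
  assumes "simple_graph Gs"
  shows "graph_order (Gs \<union>\<^sub>g complete_graph 1) = Suc (graph_order Gs)"
  using assms unfolding simple_graph_def graph_order_def disj_union_def complete_graph_def
  by (simp add: lessThan_Suc card_image card_insert_if image_iff)

lemma disj_union_K1:
  assumes "simple_graph Gs"
  shows "Gs \<union>\<^sub>g complete_graph 1 =
    (insert (Inr (0::nat)) (Inl ` vertices Gs), (\<lambda>e. Inl ` e) ` edges Gs)"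
proof -
  have E0: "{e. e \<subseteq> {..<1::nat} \<and> card e = 2} = {}"
  proof (rule equals0I)
    fix e assume "e \<in> {e. e \<subseteq> {..<1::nat} \<and> card e = 2}"
    then have "card e \<le> card {..<1::nat}" "card e = 2" by (blast intro: card_mono[OF finite_lessThan])+
    then show False by simp
  qed
  have V0: "{..<1::nat} = {0}" by auto
  show ?thesis
    unfolding disj_union_def complete_graph_def E0 unfolding V0 fst_conv snd_conv by simp
qed

text \<open>
  The assumption on the order of \<open>H\<close> supplies a vertex outside each copy of \<open>Gs\<close> that can play the
  part of the isolated vertex.
\<close>

lemma st_admissible_iff:
  fixes H :: "'b ugraph" and Gs :: "'a ugraph"
  assumes G: "simple_graph Gs" and H: "simple_graph H" and n: "graph_order H > graph_order Gs"
  shows "st_admissible H (Gs \<union>\<^sub>g complete_graph 1) \<longleftrightarrow> isolates_copies H Gs"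
proof
  assume adm: "st_admissible H (Gs \<union>\<^sub>g complete_graph 1)"
  show "isolates_copies H Gs"
    unfolding isolates_copies_def
  proof (intro allI impI ballI, rule ccontr)
    fix f e
    assume f: "embeds f Gs H" and e: "e \<in> edges H" "e \<inter> f ` vertices Gs \<noteq> {}"
      and ne: "e \<notin> (\<lambda>e. f ` e) ` edges Gs"
    let ?T = "f ` vertices Gs"
    have T: "?T \<subseteq> vertices H" "finite ?T" "card ?T = graph_order Gs" and inj: "inj_on f (vertices Gs)"
      using f G by (auto simp: embeds_def graph_order_def simple_graph_def card_image)
    have e2: "card e = 2" "e \<subseteq> vertices H" using H e by (auto simp: simple_graph_def)
    \<comment> \<open>The isolated vertex is chosen as the end of \<open>e\<close> outside the copy, if there is one.\<close>
    obtain v where v: "v \<in> vertices H" "v \<notin> ?T" "e \<subseteq> insert v ?T"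
    proof (cases "e \<subseteq> ?T")
      case True
      have "?T \<noteq> vertices H" using T(3) n unfolding graph_order_def by (metis less_irrefl)
      with T(1) obtain v where "v \<in> vertices H" "v \<notin> ?T" by blast
      then show ?thesis using that[of v] True by (simp add: subset_insertI2)
    next
      case False
      from e(2) obtain x where x: "x \<in> e" "x \<in> ?T" by blast
      obtain y where "e = {x, y}" using edge_other_end[OF H e(1) x(1)] by blast
      then show ?thesis using that[of y] x False e2 by auto
    qed
    let ?F' = "(insert v ?T, (\<lambda>e. f ` e) ` edges Gs)"
    let ?F = "(insert v ?T, insert e ((\<lambda>e. f ` e) ` edges Gs))"
    have s': "simple_graph ?F'" using simple_graph_image[OF G inj] by (auto simp: simple_graph_def)
    then have s: "simple_graph ?F" using e2 v by (auto simp: simple_graph_def)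
    have sub: "?F \<subseteq>\<^sub>g H" using s H T v f e by (auto simp: is_subgraph_def embeds_def)
    have ord: "graph_order ?F = graph_order (Gs \<union>\<^sub>g complete_graph 1)"
      using T v graph_order_union_K1[OF G] by (simp add: graph_order_def)
    have "?F' \<subseteq>\<^sub>g ?F" using s s' by (auto simp: is_subgraph_def)
    moreover have "?F' \<noteq> ?F" using ne by auto
    moreover have "(Gs \<union>\<^sub>g complete_graph 1) \<simeq>\<^sub>g ?F'"
      unfolding graph_iso_def disj_union_K1[OF G]
    proof (intro exI[of _ "case_sum f (\<lambda>_. v)"] conjI)
      show "bij_betw (case_sum f (\<lambda>_. v)) (vertices (insert (Inr (0::nat)) (Inl ` vertices Gs), (\<lambda>e. Inl ` e) ` edges Gs)) (vertices ?F')"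
        using inj v(2) by (auto simp: bij_betw_def inj_on_def image_image)
      show "edges ?F' = (\<lambda>e. case_sum f (\<lambda>_. v) ` e) ` edges (insert (Inr (0::nat)) (Inl ` vertices Gs), (\<lambda>e. Inl ` e) ` edges Gs)"
        by (simp add: image_image)
    qed
    ultimately have "contains_proper_copy ?F (Gs \<union>\<^sub>g complete_graph 1)"
      unfolding contains_proper_copy_def by blast
    then show False
      using adm sub ord unfolding st_admissible_def by blast
  qed
next
  assume iso: "isolates_copies H Gs"
  show "st_admissible H (Gs \<union>\<^sub>g complete_graph 1)"
    unfolding st_admissible_def
  proof
    assume "\<exists>F. F \<subseteq>\<^sub>g H \<and> graph_order F = graph_order (Gs \<union>\<^sub>g complete_graph 1) \<and>
      contains_proper_copy F (Gs \<union>\<^sub>g complete_graph 1)"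
    then obtain F where F: "F \<subseteq>\<^sub>g H" "graph_order F = Suc (graph_order Gs)"
      and cp: "contains_proper_copy F (Gs \<union>\<^sub>g complete_graph 1)"
      unfolding graph_order_union_K1[OF G] by blast
    from cp obtain F' where F': "F' \<subseteq>\<^sub>g F" "F' \<noteq> F" and "(Gs \<union>\<^sub>g complete_graph 1) \<simeq>\<^sub>g F'"
      unfolding contains_proper_copy_def by blast
    then obtain g where g: "bij_betw g (insert (Inr (0::nat)) (Inl ` vertices Gs)) (vertices F')"
        "edges F' = (\<lambda>e. g ` e) ` (\<lambda>e. Inl ` e) ` edges Gs"
      unfolding graph_iso_def disj_union_K1[OF G] fst_conv snd_conv by blast
    define f where "f = g \<circ> Inl"
    have V': "vertices F' = insert (g (Inr (0::nat))) (f ` vertices Gs)"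
      using g(1) by (auto simp: bij_betw_def f_def image_image)
    have E': "edges F' = (\<lambda>e. f ` e) ` edges Gs"
      using g(2) by (simp add: f_def image_image)
    have "card (vertices F') = card (insert (Inr (0::nat)) (Inl ` vertices Gs))"
      using bij_betw_same_card[OF g(1)] by simp
    also have "\<dots> = card (vertices F)"
      using F(2) G by (simp add: graph_order_def card_image simple_graph_def card_insert_if image_iff)
    finally have VV: "vertices F' = vertices F"
      using F'(1) by (intro card_subset_eq) (auto simp: is_subgraph_def simple_graph_def)
    have "edges F' \<noteq> edges F" using VV F'(2) by (auto simp: prod_eq_iff)
    then obtain e where e: "e \<in> edges F" "e \<notin> edges F'" using F'(1) by (auto simp: is_subgraph_def)
    have e2: "card e = 2" "e \<subseteq> insert (g (Inr (0::nat))) (f ` vertices Gs)"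
      using e(1) F(1) VV V' by (auto simp: is_subgraph_def simple_graph_def)
    have "e \<inter> f ` vertices Gs \<noteq> {}"
    proof
      assume "e \<inter> f ` vertices Gs = {}"
      then have "e \<subseteq> {g (Inr (0::nat))}" using e2 by blast
      then have "card e \<le> 1" using card_mono[of "{g (Inr (0::nat))}" e] by simp
      then show False using e2 by simp
    qed
    moreover have "embeds f Gs H"
      unfolding embeds_def
    proof (intro conjI)
      show "inj_on f (vertices Gs)"
        using g(1) unfolding f_def bij_betw_def by (auto simp: inj_on_def)
      show "f ` vertices Gs \<subseteq> vertices H" "\<forall>e\<in>edges Gs. f ` e \<in> edges H"
        using V' VV E' F F' by (auto simp: is_subgraph_def)
    qed
    moreover have "e \<in> edges H" using e F by (auto simp: is_subgraph_def)
    ultimately have "e \<in> (\<lambda>e. f ` e) ` edges Gs"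
      using iso unfolding isolates_copies_def by simp
    then show False using e E' by simp
  qed
qed

lemma embeds_comp_iso:
  assumes "bij_betw g (vertices G) (vertices G')" "edges G' = (\<lambda>e. g ` e) ` edges G"
    and "embeds f G' H"
  shows "embeds (f \<circ> g) G H"
  using assms unfolding embeds_def bij_betw_def
  by (auto simp: comp_inj_on image_image image_subset_iff)

lemma isolates_copies_iso_imp:
  assumes "G \<simeq>\<^sub>g G'" "isolates_copies H G"
  shows "isolates_copies H G'"
proof -
  obtain g where g: "bij_betw g (vertices G) (vertices G')" "edges G' = (\<lambda>e. g ` e) ` edges G"
    using assms(1) unfolding graph_iso_def by blast
  show ?thesis
    unfolding isolates_copies_def
  proof (intro allI impI ballI)
    fix f e assume f: "embeds f G' H" "e \<in> edges H" "e \<inter> f ` vertices G' \<noteq> {}"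
    have "(f \<circ> g) ` vertices G = f ` vertices G'"
      using g(1) by (metis bij_betw_def image_comp)
    then have "e \<in> (\<lambda>e. (f \<circ> g) ` e) ` edges G"
      using assms(2) embeds_comp_iso[OF g f(1)] f(2,3)
      unfolding isolates_copies_def by metis
    then show "e \<in> (\<lambda>e. f ` e) ` edges G'"
      using g(2) by (simp add: image_image)
  qed
qed

lemma graph_iso_sym:
  assumes "simple_graph G" "G \<simeq>\<^sub>g G'"
  shows "G' \<simeq>\<^sub>g G"
proof -
  obtain g where g: "bij_betw g (vertices G) (vertices G')" "edges G' = (\<lambda>e. g ` e) ` edges G"
    using assms(2) unfolding graph_iso_def by blast
  let ?h = "inv_into (vertices G) g"
  have "bij_betw ?h (vertices G') (vertices G)" using bij_betw_inv_into[OF g(1)] .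
  moreover have "?h ` g ` e = e" if "e \<in> edges G" for e
    using that assms(1) g(1) by (auto simp: simple_graph_def bij_betw_def inv_into_image_cancel)
  then have "edges G = (\<lambda>e. ?h ` e) ` edges G'"
    unfolding g(2) image_image by auto
  ultimately show ?thesis unfolding graph_iso_def by blast
qed

lemma isolates_copies_iso:
  assumes "simple_graph G" "G \<simeq>\<^sub>g G'"
  shows "isolates_copies H G \<longleftrightarrow> isolates_copies H G'"
  using isolates_copies_iso_imp graph_iso_sym assms by metis

lemma isolates_copiesD:
  assumes "isolates_copies H G" "embeds f G H" "e \<in> edges H" "e \<inter> f ` vertices G \<noteq> {}"
  shows "e \<in> (\<lambda>e. f ` e) ` edges G"
  using assms unfolding isolates_copies_def by metis

section \<open>Extremal numbers as maxima\<close>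

lemma graph_size_bound:
  assumes "simple_graph H" "graph_order H = n"
  shows "graph_size H \<le> 2 ^ n"
proof -
  have "edges H \<subseteq> Pow (vertices H)" "finite (vertices H)"
    using assms by (auto simp: simple_graph_def)
  then have "card (edges H) \<le> card (Pow (vertices H))" by (intro card_mono) auto
  then show ?thesis
    using assms \<open>finite _\<close> by (simp add: graph_size_def graph_order_def card_Pow)
qed

lemma ex_num_eqI:
  assumes "simple_graph (H :: nat ugraph)" "graph_order H = n" "graph_size H = m"
    "\<not> contains_copy H G"
    and "\<And>H :: nat ugraph. simple_graph H \<Longrightarrow> graph_order H = n \<Longrightarrow> \<not> contains_copy H G \<Longrightarrow>
           graph_size H \<le> m"
  shows "ex_num n G = m"
  unfolding ex_num_def by (rule Greatest_equality) (use assms in blast)+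

lemma st_num_eqI:
  assumes "simple_graph (H :: nat ugraph)" "graph_order H = n" "graph_size H = m"
    "st_admissible H G"
    and "\<And>H :: nat ugraph. simple_graph H \<Longrightarrow> graph_order H = n \<Longrightarrow> st_admissible H G \<Longrightarrow>
           graph_size H \<le> m"
  shows "st_num n G = m"
  unfolding st_num_def st_admissible_def[symmetric]
  by (rule Greatest_equality) (use assms in blast)+

lemma ex_num_attained:
  assumes "simple_graph (H0 :: nat ugraph)" "graph_order H0 = n" "\<not> contains_copy H0 G"
  obtains H :: "nat ugraph" where "simple_graph H" "graph_order H = n" "\<not> contains_copy H G"
    "graph_size H = ex_num n G"
    "\<And>H' :: nat ugraph. simple_graph H' \<Longrightarrow> graph_order H' = n \<Longrightarrow> \<not> contains_copy H' G \<Longrightarrow>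
       graph_size H' \<le> ex_num n G"
proof -
  let ?P = "\<lambda>m. \<exists>H :: nat ugraph. simple_graph H \<and>
     graph_order H = n \<and> graph_size H = m \<and> \<not> contains_copy H G"
  have ex: "?P (graph_size H0)" using assms by blast
  have bd: "\<And>y. ?P y \<Longrightarrow> y \<le> 2 ^ n" using graph_size_bound by blast
  have "?P (ex_num n G)"
    unfolding ex_num_def by (rule GreatestI_nat[of ?P, OF ex bd])
  moreover have "m \<le> ex_num n G" if "?P m" for m
    unfolding ex_num_def by (rule Greatest_le_nat[of ?P, OF that bd])
  ultimately show ?thesis using that by blast
qed

section \<open>Deleting vertices\<close>

text \<open>The graph \<open>H - U\<close> induced on the vertices outside \<open>U\<close>.\<close>

definition delete_vertices :: "'a ugraph \<Rightarrow> 'a set \<Rightarrow> 'a ugraph" where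
  "delete_vertices H U = (vertices H - U, {e \<in> edges H. e \<inter> U = {}})"

lemma simple_graph_delete_vertices:
  "simple_graph H \<Longrightarrow> simple_graph (delete_vertices H U)"
  by (auto simp: simple_graph_def delete_vertices_def)

lemma finite_edges: "simple_graph H \<Longrightarrow> finite (edges H)"
  unfolding simple_graph_def by (metis Pow_iff finite_Pow_iff finite_subset subsetI)

lemma simple_graph_edgeD:
  assumes "simple_graph H" "{a, b} \<in> edges H"
  shows "a \<noteq> b" "a \<in> vertices H" "b \<in> vertices H"
  using assms unfolding simple_graph_def by fastforce+

lemma simple_graph_edgeE:
  assumes "simple_graph H" "e \<in> edges H"
  obtains a b where "e = {a, b}" "a \<noteq> b" "a \<in> vertices H" "b \<in> vertices H"
  using assms unfolding simple_graph_def by (metis card_2_iff insert_subset)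

lemma order_delete_vertices:
  assumes "simple_graph H" "U \<subseteq> vertices H"
  shows "graph_order H = graph_order (delete_vertices H U) + card U"
proof -
  have "finite (vertices H)" using assms by (simp add: simple_graph_def)
  then show ?thesis
    using assms by (simp add: graph_order_def delete_vertices_def card_Diff_subset finite_subset card_mono)
qed

lemma size_delete_vertices:
  assumes "simple_graph H"
  shows "graph_size H = graph_size (delete_vertices H U) + card {e \<in> edges H. e \<inter> U \<noteq> {}}"
proof -
  let ?A = "{e \<in> edges H. e \<inter> U = {}}" and ?B = "{e \<in> edges H. e \<inter> U \<noteq> {}}"
  have "card (?A \<union> ?B) = card ?A + card ?B"
    using finite_edges[OF assms] by (intro card_Un_disjoint) auto
  moreover have "?A \<union> ?B = edges H" by blast
  ultimately show ?thesis
    unfolding graph_size_def delete_vertices_def by simp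
qed

section \<open>Copies of small paths, triangles and paws\<close>

lemma path_graph_3: "path_graph 3 = ({0, 1, 2}, {{0, 1}, {1, 2}})"
proof -
  have "Suc i < 3 \<longleftrightarrow> i = 0 \<or> i = 1" for i by arith
  then have "{{i, Suc i} | i. Suc i < 3} = {{0, 1}, {1, 2}}"
    by (auto simp: numeral_2_eq_2)
  moreover have "{..<3::nat} = {0, 1, 2}"
    by (auto simp: lessThan_nat_numeral lessThan_Suc)
  ultimately show ?thesis unfolding path_graph_def by simp
qed

lemma edges_complete_graph_Suc:
  "edges (complete_graph (Suc n)) = (\<lambda>i. {i, n}) ` {..<n} \<union> edges (complete_graph n)"
proof (intro set_eqI iffI)
  fix e assume "e \<in> edges (complete_graph (Suc n))"
  then have e: "e \<subseteq> {..<Suc n}" "card e = 2" by (auto simp: complete_graph_def)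
  then obtain x y where "e = {x, y}" "x \<noteq> y" by (auto simp: card_2_iff)
  with e show "e \<in> (\<lambda>i. {i, n}) ` {..<n} \<union> edges (complete_graph n)"
    by (auto simp: complete_graph_def less_Suc_eq insert_commute)
qed (auto simp: complete_graph_def less_Suc_eq)

lemma complete_graph_2: "complete_graph 2 = ({0, 1}, {{0, 1}})"
proof -
  have V: "{..<1} = {0::nat}" "{..<2} = {0, 1::nat}"
    by (auto simp: lessThan_nat_numeral lessThan_Suc)
  have "edges (complete_graph 1) = {}"
    using edges_complete_graph_Suc[of 0] card_mono[of "{}::nat set"]
    by (auto simp: complete_graph_def)
  then have "edges (complete_graph 2) = {{0, 1}}"
    using edges_complete_graph_Suc[of 1] unfolding V Suc_1 by auto
  then show ?thesis using V by (simp add: complete_graph_def)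
qed

lemma complete_graph_3: "complete_graph 3 = ({0, 1, 2}, {{0, 1}, {0, 2}, {1, 2}})"
proof -
  have V: "{..<2} = {0, 1::nat}" "{..<3} = {0, 1, 2::nat}"
    by (auto simp: lessThan_nat_numeral lessThan_Suc)
  have "edges (complete_graph 3) = {{0, 1}, {0, 2}, {1, 2}}"
    using edges_complete_graph_Suc[of 2] unfolding V complete_graph_2 by auto
  then show ?thesis using V by (simp add: complete_graph_def)
qed

lemma complete_graph_4:
  "complete_graph 4 = ({0, 1, 2, 3}, {{0, 1}, {0, 2}, {0, 3}, {1, 2}, {1, 3}, {2, 3}})"
proof -
  have V: "{..<3} = {0, 1, 2::nat}" "{..<4} = {0, 1, 2, 3::nat}"
    by (auto simp: lessThan_nat_numeral lessThan_Suc)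
  have "edges (complete_graph 4) = {{0, 1}, {0, 2}, {0, 3}, {1, 2}, {1, 3}, {2, 3}}"
    using edges_complete_graph_Suc[of 3] unfolding V complete_graph_3 by auto
  then show ?thesis using V by (simp add: complete_graph_def)
qed

text \<open>
  The triangle \<open>0, 2, 3\<close> with the pendant edge from \<open>3\<close> to \<open>1\<close>, known as the paw.
\<close>

lemma paw_eq:
  "delete_edges (complete_graph 4) (path_graph 3) = ({0, 1, 2, 3}, {{0, 2}, {0, 3}, {1, 3}, {2, 3}})"
  unfolding delete_edges_def complete_graph_4 path_graph_3 by (auto simp: doubleton_eq_iff)

lemma contains_path_3_iff:
  assumes "simple_graph H"
  shows "contains_copy H (path_graph 3) \<longleftrightarrow>
    (\<exists>a b c. a \<noteq> c \<and> {a, b} \<in> edges H \<and> {b, c} \<in> edges H)"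
proof -
  have s: "simple_graph (path_graph 3)" by (auto simp: path_graph_3 simple_graph_def)
  show ?thesis
    unfolding contains_copy_iff[OF s assms]
  proof
    assume "\<exists>f. embeds f (path_graph 3) H"
    then obtain f where "embeds f (path_graph 3) H" by blast
    then have "f 0 \<noteq> f 2" "{f 0, f 1} \<in> edges H" "{f 1, f 2} \<in> edges H"
      unfolding embeds_def path_graph_3 by (auto simp: inj_on_def)
    then show "\<exists>a b c. a \<noteq> c \<and> {a, b} \<in> edges H \<and> {b, c} \<in> edges H" by blast
  next
    assume "\<exists>a b c. a \<noteq> c \<and> {a, b} \<in> edges H \<and> {b, c} \<in> edges H"
    then obtain a b c where *: "a \<noteq> c" "{a, b} \<in> edges H" "{b, c} \<in> edges H" by blast
    then have "embeds (\<lambda>i::nat. if i = 0 then a else if i = 1 then b else c) (path_graph 3) H"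
      using simple_graph_edgeD[OF assms] unfolding embeds_def path_graph_3 by (auto simp: insert_commute)
    then show "\<exists>f. embeds f (path_graph 3) H" by blast
  qed
qed

lemma isolates_K2_iff:
  assumes "simple_graph H"
  shows "isolates_copies H (complete_graph 2) \<longleftrightarrow> \<not> contains_copy H (path_graph 3)"
  unfolding contains_path_3_iff[OF assms]
proof
  assume iso: "isolates_copies H (complete_graph 2)"
  show "\<not> (\<exists>a b c. a \<noteq> c \<and> {a, b} \<in> edges H \<and> {b, c} \<in> edges H)"
  proof
    assume "\<exists>a b c. a \<noteq> c \<and> {a, b} \<in> edges H \<and> {b, c} \<in> edges H"
    then obtain a b c where *: "a \<noteq> c" "{a, b} \<in> edges H" "{b, c} \<in> edges H" by blast
    let ?f = "\<lambda>i::nat. if i = 0 then a else b"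
    have 1: "embeds ?f (complete_graph 2) H"
      using * simple_graph_edgeD[OF assms] unfolding embeds_def complete_graph_2 by (auto simp: insert_commute)
    have 2: "{b, c} \<inter> ?f ` vertices (complete_graph 2) \<noteq> {}"
      unfolding complete_graph_2 by auto
    have "{b, c} \<in> (\<lambda>e. ?f ` e) ` edges (complete_graph 2)"
      by (rule isolates_copiesD[OF iso 1 *(3) 2])
    then show False
      using * simple_graph_edgeD[OF assms] unfolding complete_graph_2 by (auto simp: doubleton_eq_iff)
  qed
next
  assume *: "\<not> (\<exists>a b c. a \<noteq> c \<and> {a, b} \<in> edges H \<and> {b, c} \<in> edges H)"
  show "isolates_copies H (complete_graph 2)"
    unfolding isolates_copies_def
  proof (intro allI impI ballI)
    fix f :: "nat \<Rightarrow> 'a" and e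
    assume f: "embeds f (complete_graph 2) H" and e: "e \<in> edges H"
      "e \<inter> f ` vertices (complete_graph 2) \<noteq> {}"
    have f01: "{f 0, f 1} \<in> edges H" using f by (auto simp: embeds_def complete_graph_2)
    then have f10: "{f 1, f 0} \<in> edges H" by (simp add: insert_commute)
    have unique: "y = z" if "{x, y} \<in> edges H" "{x, z} \<in> edges H" for x y z
      using * that by (metis insert_commute)
    obtain x where x: "x \<in> e" "x = f 0 \<or> x = f 1" using e(2) by (auto simp: complete_graph_2)
    then obtain y where y: "e = {x, y}"
      using edge_other_end[OF assms e(1) x(1)] by blast
    from x(2) have "e = {f 0, f 1}"
    proof
      assume "x = f 0"
      then show ?thesis using unique[of x y "f 1"] e(1) f01 y by simp
    next
      assume "x = f 1"
      then show ?thesis using unique[of x y "f 0"] e(1) f10 y by (simp add: insert_commute)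
    qed
    then show "e \<in> (\<lambda>e. f ` e) ` edges (complete_graph 2)"
      by (simp add: complete_graph_2)
  qed
qed

lemma isolates_P3_iff:
  assumes "simple_graph H"
  shows "isolates_copies H (path_graph 3) \<longleftrightarrow>
    (\<forall>a b c. a \<noteq> c \<longrightarrow> {a, b} \<in> edges H \<longrightarrow> {b, c} \<in> edges H \<longrightarrow>
      {e \<in> edges H. e \<inter> {a, b, c} \<noteq> {}} = {{a, b}, {b, c}})" (is "_ \<longleftrightarrow> ?R")
proof
  assume iso: "isolates_copies H (path_graph 3)"
  show ?R
  proof (intro allI impI)
    fix a b c assume *: "a \<noteq> c" "{a, b} \<in> edges H" "{b, c} \<in> edges H"
    let ?f = "\<lambda>i::nat. if i = 0 then a else if i = 1 then b else c"
    have 1: "embeds ?f (path_graph 3) H"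
      using * simple_graph_edgeD[OF assms] unfolding embeds_def path_graph_3 by (auto simp: insert_commute)
    have 2: "?f ` vertices (path_graph 3) = {a, b, c}"
      "(\<lambda>e. ?f ` e) ` edges (path_graph 3) = {{a, b}, {b, c}}"
      unfolding path_graph_3 by (simp_all add: insert_commute)
    have "\<forall>e\<in>edges H. e \<inter> {a, b, c} \<noteq> {} \<longrightarrow> e \<in> {{a, b}, {b, c}}"
      using isolates_copiesD[OF iso 1] unfolding 2 by blast
    then show "{e \<in> edges H. e \<inter> {a, b, c} \<noteq> {}} = {{a, b}, {b, c}}" using * by blast
  qed
next
  assume R: ?R
  show "isolates_copies H (path_graph 3)"
    unfolding isolates_copies_def
  proof (intro allI impI ballI)
    fix f :: "nat \<Rightarrow> 'a" and e
    assume f: "embeds f (path_graph 3) H" and e: "e \<in> edges H"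
      "e \<inter> f ` vertices (path_graph 3) \<noteq> {}"
    have "f 0 \<noteq> f 2" "{f 0, f 1} \<in> edges H" "{f 1, f 2} \<in> edges H"
      using f unfolding embeds_def path_graph_3 by (auto simp: inj_on_def)
    with R have "{e \<in> edges H. e \<inter> {f 0, f 1, f 2} \<noteq> {}} = {{f 0, f 1}, {f 1, f 2}}"
      by blast
    moreover have "e \<in> {e \<in> edges H. e \<inter> {f 0, f 1, f 2} \<noteq> {}}"
      using e unfolding path_graph_3 by auto
    ultimately show "e \<in> (\<lambda>e. f ` e) ` edges (path_graph 3)"
      unfolding path_graph_3 by auto
  qed
qed

text \<open>In a simple graph the three vertices of a triangle are automatically distinct.\<close>

definition triangle :: "'a ugraph \<Rightarrow> 'a \<Rightarrow> 'a \<Rightarrow> 'a \<Rightarrow> bool" where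
  "triangle H a b c \<longleftrightarrow> {a, b} \<in> edges H \<and> {a, c} \<in> edges H \<and> {b, c} \<in> edges H"

lemma contains_K3_iff:
  assumes "simple_graph H"
  shows "contains_copy H (complete_graph 3) \<longleftrightarrow> (\<exists>a b c. triangle H a b c)"
proof -
  have s: "simple_graph (complete_graph 3)" by (auto simp: complete_graph_3 simple_graph_def)
  show ?thesis
    unfolding contains_copy_iff[OF s assms]
  proof
    assume "\<exists>f. embeds f (complete_graph 3) H"
    then obtain f where "embeds f (complete_graph 3) H" by blast
    then have "triangle H (f 0) (f 1) (f 2)"
      unfolding embeds_def complete_graph_3 triangle_def by (auto simp: insert_commute)
    then show "\<exists>a b c. triangle H a b c" by blast
  next
    assume "\<exists>a b c. triangle H a b c"
    then obtain a b c where "triangle H a b c" by blast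
    then have "embeds (\<lambda>i::nat. if i = 0 then a else if i = 1 then b else c) (complete_graph 3) H"
      using simple_graph_edgeD[OF assms] unfolding embeds_def complete_graph_3 triangle_def by (auto simp: insert_commute)
    then show "\<exists>f. embeds f (complete_graph 3) H" by blast
  qed
qed

lemma isolates_K3_iff:
  assumes "simple_graph H"
  shows "isolates_copies H (complete_graph 3) \<longleftrightarrow>
    (\<forall>a b c. triangle H a b c \<longrightarrow>
      {e \<in> edges H. e \<inter> {a, b, c} \<noteq> {}} = {{a, b}, {a, c}, {b, c}})" (is "_ \<longleftrightarrow> ?R")
proof
  assume iso: "isolates_copies H (complete_graph 3)"
  show ?R
  proof (intro allI impI)
    fix a b c assume *: "triangle H a b c"
    let ?f = "\<lambda>i::nat. if i = 0 then a else if i = 1 then b else c"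
    have 1: "embeds ?f (complete_graph 3) H"
      using * simple_graph_edgeD[OF assms] unfolding embeds_def complete_graph_3 triangle_def by (auto simp: insert_commute)
    have 2: "?f ` vertices (complete_graph 3) = {a, b, c}"
      "(\<lambda>e. ?f ` e) ` edges (complete_graph 3) = {{a, b}, {a, c}, {b, c}}"
      unfolding complete_graph_3 by (simp_all add: insert_commute)
    have "\<forall>e\<in>edges H. e \<inter> {a, b, c} \<noteq> {} \<longrightarrow> e \<in> {{a, b}, {a, c}, {b, c}}"
      using isolates_copiesD[OF iso 1] unfolding 2 by blast
    then show "{e \<in> edges H. e \<inter> {a, b, c} \<noteq> {}} = {{a, b}, {a, c}, {b, c}}"
      using * unfolding triangle_def by blast
  qed
next
  assume R: ?R
  show "isolates_copies H (complete_graph 3)"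
    unfolding isolates_copies_def
  proof (intro allI impI ballI)
    fix f :: "nat \<Rightarrow> 'a" and e
    assume f: "embeds f (complete_graph 3) H" and e: "e \<in> edges H"
      "e \<inter> f ` vertices (complete_graph 3) \<noteq> {}"
    have "triangle H (f 0) (f 1) (f 2)"
      using f unfolding embeds_def complete_graph_3 triangle_def by simp
    with R have "{e \<in> edges H. e \<inter> {f 0, f 1, f 2} \<noteq> {}} = {{f 0, f 1}, {f 0, f 2}, {f 1, f 2}}"
      by blast
    moreover have "e \<in> {e \<in> edges H. e \<inter> {f 0, f 1, f 2} \<noteq> {}}"
      using e unfolding complete_graph_3 by auto
    ultimately show "e \<in> (\<lambda>e. f ` e) ` edges (complete_graph 3)"
      unfolding complete_graph_3 by auto
  qed
qed

lemma contains_paw_iff: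
  assumes "simple_graph H"
  shows "contains_copy H (delete_edges (complete_graph 4) (path_graph 3)) \<longleftrightarrow>
    \<not> isolates_copies H (complete_graph 3)"
proof -
  have s: "simple_graph (delete_edges (complete_graph 4) (path_graph 3))"
    by (auto simp: paw_eq simple_graph_def)
  show ?thesis
    unfolding contains_copy_iff[OF s assms] isolates_K3_iff[OF assms]
  proof
    assume "\<exists>f. embeds f (delete_edges (complete_graph 4) (path_graph 3)) H"
    then obtain f where f: "embeds f (delete_edges (complete_graph 4) (path_graph 3)) H" by blast
    then have t: "triangle H (f 0) (f 2) (f 3)" and e: "{f 1, f 3} \<in> edges H"
      and ne: "f 1 \<noteq> f 0" "f 1 \<noteq> f 2" "f 1 \<noteq> f 3"
      unfolding embeds_def paw_eq triangle_def by (auto simp: inj_on_def)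
    have out: "{f 1, f 3} \<notin> {{f 0, f 2}, {f 0, f 3}, {f 2, f 3}}"
      using ne by (auto simp: doubleton_eq_iff)
    show "\<not> (\<forall>a b c. triangle H a b c \<longrightarrow>
      {e \<in> edges H. e \<inter> {a, b, c} \<noteq> {}} = {{a, b}, {a, c}, {b, c}})"
    proof
      assume "\<forall>a b c. triangle H a b c \<longrightarrow>
        {e \<in> edges H. e \<inter> {a, b, c} \<noteq> {}} = {{a, b}, {a, c}, {b, c}}"
      from this[rule_format, OF t]
      have "{f 1, f 3} \<in> edges H \<and> {f 1, f 3} \<inter> {f 0, f 2, f 3} \<noteq> {} \<longleftrightarrow>
        {f 1, f 3} \<in> {{f 0, f 2}, {f 0, f 3}, {f 2, f 3}}" unfolding set_eq_iff mem_Collect_eq by (rule spec)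
      with e out show False by simp
    qed
  next
    assume "\<not> (\<forall>a b c. triangle H a b c \<longrightarrow>
      {e \<in> edges H. e \<inter> {a, b, c} \<noteq> {}} = {{a, b}, {a, c}, {b, c}})"
    then obtain a b c where t: "triangle H a b c"
      and "{e \<in> edges H. e \<inter> {a, b, c} \<noteq> {}} \<noteq> {{a, b}, {a, c}, {b, c}}" by blast
    then obtain e where e: "e \<in> edges H" "e \<inter> {a, b, c} \<noteq> {}" "e \<notin> {{a, b}, {a, c}, {b, c}}"
      unfolding triangle_def by blast
    then obtain x where x2: "x \<in> {a, b, c}" "x \<in> e" by blast
    then obtain d where x: "e = {x, d}" "x \<in> {a, b, c}" "x \<noteq> d"
      using edge_other_end[OF assms e(1) x2(2)] by metis
    have "\<exists>y z. triangle H y z x \<and> {x, y, z} = {a, b, c}"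
      using x(2)
    proof (elim insertE emptyE)
      assume "x = a" then show ?thesis
        using t by (intro exI[of _ b] exI[of _ c]) (auto simp: triangle_def insert_commute)
    next
      assume "x = b" then show ?thesis
        using t by (intro exI[of _ a] exI[of _ c]) (auto simp: triangle_def insert_commute)
    next
      assume "x = c" then show ?thesis
        using t by (intro exI[of _ a] exI[of _ b]) (auto simp: triangle_def insert_commute)
    qed
    then obtain y z where yz: "triangle H y z x" "{x, y, z} = {a, b, c}" by blast
    have "d \<notin> {a, b, c}"
      using e(3) x by (auto simp: insert_commute)
    then have d: "d \<notin> {x, y, z}" unfolding yz(2) .
    have "embeds (\<lambda>i::nat. if i = 0 then y else if i = 1 then d else if i = 2 then z else x)
        (delete_edges (complete_graph 4) (path_graph 3)) H"
      using yz(1) d e(1) simple_graph_edgeD[OF assms] unfolding x(1) embeds_def paw_eq triangle_def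
      by (auto simp: insert_commute)
    then show "\<exists>f. embeds f (delete_edges (complete_graph 4) (path_graph 3)) H" by blast
  qed
qed

section \<open>Counting edges\<close>

lemma matching_size:
  assumes "simple_graph H" "\<not> contains_copy H (path_graph 3)"
  shows "2 * graph_size H \<le> graph_order H"
proof -
  have disj: "pairwise disjnt (edges H)"
    unfolding pairwise_def
  proof (intro ballI impI)
    fix e e' assume e: "e \<in> edges H" "e' \<in> edges H" "e \<noteq> e'"
    show "disjnt e e'"
    proof (rule ccontr)
      assume "\<not> disjnt e e'"
      then obtain x where x: "x \<in> e" "x \<in> e'" by (auto simp: disjnt_def)
      obtain y where y: "e = {x, y}"
        using edge_other_end[OF assms(1) e(1) x(1)] by blast
      obtain z where z: "e' = {x, z}"
        using edge_other_end[OF assms(1) e(2) x(2)] by blast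
      have "y \<noteq> z" "{y, x} \<in> edges H" "{x, z} \<in> edges H"
        using e y z by (auto simp: insert_commute)
      then show False using assms(2) unfolding contains_path_3_iff[OF assms(1)] by blast
    qed
  qed
  have fin: "finite e" "card e = 2" if "e \<in> edges H" for e
    using that assms(1) unfolding simple_graph_def by (auto intro: card_ge_0_finite)
  have "card (\<Union>(edges H)) = (\<Sum>e\<in>edges H. card e)"
    using disj fin(1) by (rule card_Union_disjoint)
  also have "\<dots> = 2 * card (edges H)" using fin(2) by simp
  finally have "2 * card (edges H) = card (\<Union>(edges H))" by simp
  also have "\<dots> \<le> card (vertices H)"
    using assms(1) unfolding simple_graph_def by (intro card_mono) auto
  finally show ?thesis by (simp add: graph_size_def graph_order_def)
qed

lemma isolates_P3_size:
  assumes "simple_graph H" "isolates_copies H (path_graph 3)"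
  shows "3 * graph_size H \<le> 2 * graph_order H"
  using assms
proof (induction "graph_order H" arbitrary: H rule: less_induct)
  case less
  show ?case
  proof (cases "contains_copy H (path_graph 3)")
    case False
    then show ?thesis using matching_size[OF less.prems(1)] by simp
  next
    case True
    then obtain a b c where P: "a \<noteq> c" "{a, b} \<in> edges H" "{b, c} \<in> edges H"
      unfolding contains_path_3_iff[OF less.prems(1)] by blast
    let ?U = "{a, b, c}" and ?H = "delete_vertices H {a, b, c}"
    have ab: "a \<noteq> b" "b \<noteq> c" and U: "?U \<subseteq> vertices H"
      using P simple_graph_edgeD[OF less.prems(1)] by blast+
    have cU: "card ?U = 3" using ab P(1) by simp
    have order: "graph_order H = graph_order ?H + 3"
      using order_delete_vertices[OF less.prems(1) U] cU by simp
    have sH: "simple_graph ?H" by (rule simple_graph_delete_vertices[OF less.prems(1)])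
    have iso: "{e \<in> edges H. e \<inter> {x, y, z} \<noteq> {}} = {{x, y}, {y, z}}"
      if "x \<noteq> z" "{x, y} \<in> edges H" "{y, z} \<in> edges H" for x y z
      using less.prems(2) that unfolding isolates_P3_iff[OF less.prems(1)] by blast
    have "isolates_copies ?H (path_graph 3)"
      unfolding isolates_P3_iff[OF sH]
    proof (intro allI impI)
      fix x y z assume xyz: "x \<noteq> z" "{x, y} \<in> edges ?H" "{y, z} \<in> edges ?H"
      then have "{e \<in> edges H. e \<inter> {x, y, z} \<noteq> {}} = {{x, y}, {y, z}}"
        by (intro iso) (auto simp: delete_vertices_def)
      moreover have "{e \<in> edges ?H. e \<inter> {x, y, z} \<noteq> {}} =
          {e \<in> edges H. e \<inter> {x, y, z} \<noteq> {}} \<inter> edges ?H"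
        unfolding delete_vertices_def by auto
      ultimately show "{e \<in> edges ?H. e \<inter> {x, y, z} \<noteq> {}} = {{x, y}, {y, z}}"
        using xyz by simp
    qed
    then have "3 * graph_size ?H \<le> 2 * graph_order ?H"
      using less.hyps[OF _ sH] order by simp
    moreover have "card {{a, b}, {b, c}} = 2" using P(1) ab by (auto simp: doubleton_eq_iff)
    then have "graph_size H = graph_size ?H + 2"
      using size_delete_vertices[OF less.prems(1), of ?U] unfolding iso[OF P] by simp
    ultimately show ?thesis using order by simp
  qed
qed

lemma triangle_free_delete_vertices:
  "triangle (delete_vertices H U) a b c \<Longrightarrow> triangle H a b c"
  by (simp add: triangle_def delete_vertices_def)

lemma Mantel:
  assumes "simple_graph H" "\<And>a b c. \<not> triangle H a b c"
  shows "4 * graph_size H \<le> (graph_order H)\<^sup>2"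
  using assms
proof (induction "graph_order H" arbitrary: H rule: less_induct)
  case less
  show ?case
  proof (cases "edges H = {}")
    case True
    then show ?thesis by (simp add: graph_size_def)
  next
    case False
    then obtain u v where uv: "{u, v} \<in> edges H" "u \<noteq> v" "{u, v} \<subseteq> vertices H"
      using simple_graph_edgeE[OF less.prems(1)] by (metis all_not_in_conv bot_least insert_subset)
    let ?H = "delete_vertices H {u, v}"
    have order: "graph_order H = graph_order ?H + 2"
      using order_delete_vertices[OF less.prems(1) uv(3)] uv(2) by simp
    have sH: "simple_graph ?H" by (rule simple_graph_delete_vertices[OF less.prems(1)])
    have IH: "4 * graph_size ?H \<le> (graph_order ?H)\<^sup>2"
      using less.hyps[OF _ sH] order less.prems(2) triangle_free_delete_vertices by (metis add_lessD1 less_add_same_cancel1 zero_less_numeral)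
    \<comment> \<open>No vertex is adjacent to both \<open>u\<close> and \<open>v\<close>, so it accounts for at most one deleted edge.\<close>
    let ?g = "\<lambda>w. if {u, w} \<in> edges H then {u, w} else {v, w}"
    have "{e \<in> edges H. e \<inter> {u, v} \<noteq> {}} \<subseteq> insert {u, v} (?g ` vertices ?H)"
    proof
      fix e assume "e \<in> {e \<in> edges H. e \<inter> {u, v} \<noteq> {}}"
      then obtain x where e: "e \<in> edges H" and x: "x \<in> e" "x = u \<or> x = v" by blast
      then obtain w where w: "e = {x, w}"
        using edge_other_end[OF less.prems(1) e x(1)] by blast
      have wV: "w \<in> vertices H" "w \<noteq> x" using simple_graph_edgeD[OF less.prems(1)] e w by auto
      show "e \<in> insert {u, v} (?g ` vertices ?H)"
      proof (cases "w = u \<or> w = v")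
        case True
        then show ?thesis using w x wV by (auto simp: insert_commute)
      next
        case False
        then have "w \<in> vertices ?H" using wV by (simp add: delete_vertices_def)
        moreover have "e = ?g w"
        proof (cases "x = u")
          case True
          then show ?thesis using w e by simp
        next
          case False
          then have "x = v" using x by simp
          moreover have "\<not> triangle H u v w" by (rule less.prems(2))
          ultimately show ?thesis using w e uv(1) unfolding triangle_def by simp
        qed
        ultimately show ?thesis by blast
      qed
    qed
    then have "card {e \<in> edges H. e \<inter> {u, v} \<noteq> {}} \<le> card (insert {u, v} (?g ` vertices ?H))"
      using sH by (intro card_mono) (auto simp: simple_graph_def)
    also have "\<dots> \<le> Suc (card (?g ` vertices ?H))"
      by (rule card_insert_le_m1[of "Suc _", simplified]) simp_all
    also have "\<dots> \<le> Suc (graph_order ?H)"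
      using sH card_image_le[of "vertices ?H" ?g] by (simp add: simple_graph_def graph_order_def)
    finally have "graph_size H \<le> graph_size ?H + Suc (graph_order ?H)"
      using size_delete_vertices[OF less.prems(1), of "{u, v}"] by simp
    with IH show ?thesis unfolding order by (simp add: power2_eq_square algebra_simps)
  qed
qed

lemma isolates_K3D:
  assumes "simple_graph H" "isolates_copies H (complete_graph 3)" "triangle H a b c"
  shows "{e \<in> edges H. e \<inter> {a, b, c} \<noteq> {}} = {{a, b}, {a, c}, {b, c}}"
  using assms(2)[unfolded isolates_K3_iff[OF assms(1)], rule_format, OF assms(3)] .

text \<open>
  A single triangle exceeds the bound \<open>n\<^sup>2 / 4\<close>. The correction term for order 3 lets the induction pass
  through this case.
\<close>

lemma isolates_K3_size_aux:
  assumes "simple_graph H" "isolates_copies H (complete_graph 3)"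
  shows "4 * graph_size H \<le> (graph_order H)\<^sup>2 + (if graph_order H = 3 then 3 else 0)"
  using assms
proof (induction "graph_order H" arbitrary: H rule: less_induct)
  case less
  show ?case
  proof (cases "\<exists>a b c. triangle H a b c")
    case False
    then show ?thesis using Mantel[OF less.prems(1)] by simp
  next
    case True
    then obtain a b c where P: "triangle H a b c" by blast
    let ?U = "{a, b, c}" and ?H = "delete_vertices H {a, b, c}"
    have ab: "a \<noteq> b" "b \<noteq> c" "a \<noteq> c" and U: "?U \<subseteq> vertices H"
      using P simple_graph_edgeD[OF less.prems(1)] unfolding triangle_def by blast+
    have cU: "card ?U = 3" using ab by simp
    have order: "graph_order H = graph_order ?H + 3"
      using order_delete_vertices[OF less.prems(1) U] cU by simp
    have sH: "simple_graph ?H" by (rule simple_graph_delete_vertices[OF less.prems(1)])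
    have iso: "{e \<in> edges H. e \<inter> {x, y, z} \<noteq> {}} = {{x, y}, {x, z}, {y, z}}"
      if "triangle H x y z" for x y z
      by (rule isolates_K3D[OF less.prems that])
    have "isolates_copies ?H (complete_graph 3)"
      unfolding isolates_K3_iff[OF sH]
    proof (intro allI impI)
      fix x y z assume xyz: "triangle ?H x y z"
      then have "{e \<in> edges H. e \<inter> {x, y, z} \<noteq> {}} = {{x, y}, {x, z}, {y, z}}"
        by (rule iso[OF triangle_free_delete_vertices])
      moreover have "{e \<in> edges ?H. e \<inter> {x, y, z} \<noteq> {}} =
          {e \<in> edges H. e \<inter> {x, y, z} \<noteq> {}} \<inter> edges ?H"
        unfolding delete_vertices_def by auto
      ultimately show "{e \<in> edges ?H. e \<inter> {x, y, z} \<noteq> {}} = {{x, y}, {x, z}, {y, z}}"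
        using xyz unfolding triangle_def by simp
    qed
    then have IH: "4 * graph_size ?H \<le> (graph_order ?H)\<^sup>2 + (if graph_order ?H = 3 then 3 else 0)"
      using less.hyps[OF _ sH] order by simp
    have "card {{a, b}, {a, c}, {b, c}} = 3" using ab by (auto simp: doubleton_eq_iff)
    then have "graph_size H = graph_size ?H + 3"
      using size_delete_vertices[OF less.prems(1), of ?U] unfolding iso[OF P] by simp
    with IH order show ?thesis
      by (cases "graph_order ?H") (auto simp: power2_eq_square algebra_simps split: if_splits)
  qed
qed

lemma isolates_K3_size:
  assumes "simple_graph H" "isolates_copies H (complete_graph 3)" "graph_order H \<noteq> 3"
  shows "graph_size H \<le> (graph_order H)\<^sup>2 div 4"
  using isolates_K3_size_aux[OF assms(1,2)] assms(3) by simp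

lemma balanced_bipartite_exists:
  assumes "finite U"
  obtains B where "simple_graph (U, B)" "card B = (card U)\<^sup>2 div 4" "\<And>a b c. \<not> triangle (U, B) a b c"
proof -
  obtain A where A: "A \<subseteq> U" "card A = card U div 2"
    by (metis div_le_dividend obtain_subset_with_card_n)
  define B where "B = (\<lambda>(x, y). {x, y}) ` (A \<times> (U - A))"
  have side: "x \<in> A \<longleftrightarrow> y \<notin> A" if "{x, y} \<in> B" for x y
    using that unfolding B_def by (auto simp: doubleton_eq_iff)
  have "simple_graph (U, B)"
    using assms A(1) unfolding simple_graph_def B_def by (auto simp: card_2_iff)
  moreover have "card B = (card U)\<^sup>2 div 4"
  proof -
    have "inj_on (\<lambda>(x, y). {x, y}) (A \<times> (U - A))"
      by (auto simp: inj_on_def doubleton_eq_iff)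
    then have "card B = card U div 2 * (card U - card U div 2)"
      using A assms unfolding B_def
      by (simp add: card_image card_cartesian_product card_Diff_subset finite_subset)
    also have "\<dots> = (card U)\<^sup>2 div 4"
    proof (cases "even (card U)")
      case True
      then obtain k where "card U = 2 * k" by blast
      then show ?thesis by (simp add: power2_eq_square)
    next
      case False
      then obtain k where k: "card U = 2 * k + 1" by (elim oddE)
      have "(2 * k + 1)\<^sup>2 = 4 * (k * k + k) + (1::nat)" by (simp add: power2_eq_square algebra_simps)
      then have "(2 * k + 1)\<^sup>2 div 4 = k * k + k" by presburger
      then show ?thesis by (simp add: k algebra_simps)
    qed
    finally show ?thesis .
  qed
  moreover have "\<not> triangle (U, B) a b c" for a b c
    using side unfolding triangle_def snd_conv by blast
  ultimately show ?thesis using that by blast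
qed

section \<open>The single edge, the path and the triangle\<close>

lemma st_num_union_K1_eqI:
  assumes "simple_graph Gs" "n > graph_order Gs"
    and "simple_graph (H :: nat ugraph)" "graph_order H = n" "graph_size H = m" "isolates_copies H Gs"
    and "\<And>H :: nat ugraph. simple_graph H \<Longrightarrow> graph_order H = n \<Longrightarrow> isolates_copies H Gs \<Longrightarrow>
           graph_size H \<le> m"
  shows "st_num n (Gs \<union>\<^sub>g complete_graph 1) = m"
proof (rule st_num_eqI[OF assms(3,4,5)])
  show "st_admissible H (Gs \<union>\<^sub>g complete_graph 1)"
    using st_admissible_iff[OF assms(1,3)] assms by simp
  fix H' :: "nat ugraph"
  assume H': "simple_graph H'" "graph_order H' = n" "st_admissible H' (Gs \<union>\<^sub>g complete_graph 1)"
  then show "graph_size H' \<le> m"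
    using st_admissible_iff[OF assms(1) H'(1)] assms(2,7) by simp
qed

lemma matching_exists:
  obtains H :: "nat ugraph" where "simple_graph H" "graph_order H = n" "graph_size H = n div 2"
    "\<not> contains_copy H (path_graph 3)"
proof -
  let ?H = "({..<n}, (\<lambda>i. {2 * i, 2 * i + 1}) ` {..<n div 2})"
  have s: "simple_graph ?H" by (auto simp: simple_graph_def)
  have partner: "y = (if even x then x + 1 else x - 1)" if "{x, y} \<in> edges ?H" for x y
    using that by (auto simp: doubleton_eq_iff)
  have "inj_on (\<lambda>i::nat. {2 * i, 2 * i + 1}) {..<n div 2}"
  proof (rule inj_onI)
    fix i j :: nat assume "{2 * i, 2 * i + 1} = {2 * j, 2 * j + 1}"
    then have "2 * i = 2 * j \<or> 2 * i = 2 * j + 1 \<and> 2 * i + 1 = 2 * j" by (simp add: doubleton_eq_iff)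
    then show "i = j" by presburger
  qed
  then have "graph_size ?H = n div 2" by (simp add: graph_size_def card_image)
  moreover have "\<not> contains_copy ?H (path_graph 3)"
    unfolding contains_path_3_iff[OF s]
  proof
    assume "\<exists>a b c. a \<noteq> c \<and> {a, b} \<in> edges ?H \<and> {b, c} \<in> edges ?H"
    then obtain a b c where *: "a \<noteq> c" "{a, b} \<in> edges ?H" "{b, c} \<in> edges ?H" by blast
    have "{b, a} \<in> edges ?H" using *(2) by (simp only: insert_commute)
    then have "a = c" using partner[OF *(3)] partner[of b a] by simp
    with *(1) show False by simp
  qed
  ultimately show ?thesis using that[OF s] by (simp add: graph_order_def)
qed

lemma ex_num_P3: "ex_num n (path_graph 3) = n div 2"
proof -
  obtain H :: "nat ugraph" where H: "simple_graph H" "graph_order H = n" "graph_size H = n div 2"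
    "\<not> contains_copy H (path_graph 3)" by (rule matching_exists)
  show ?thesis
  proof (rule ex_num_eqI[OF H])
    fix H' :: "nat ugraph"
    assume "simple_graph H'" "graph_order H' = n" "\<not> contains_copy H' (path_graph 3)"
    then show "graph_size H' \<le> n div 2" using matching_size[of H'] by simp
  qed
qed

lemma st_num_K2:
  assumes "simple_graph Gs" "Gs \<simeq>\<^sub>g complete_graph 2" "n > graph_order Gs"
  shows "st_num n (Gs \<union>\<^sub>g complete_graph 1) = n div 2"
proof -
  have iff: "isolates_copies H Gs \<longleftrightarrow> \<not> contains_copy H (path_graph 3)" if "simple_graph H"
    for H :: "nat ugraph"
    using isolates_copies_iso[OF assms(1,2), of H] isolates_K2_iff[OF that] by simp
  obtain H :: "nat ugraph" where H: "simple_graph H" "graph_order H = n" "graph_size H = n div 2"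
    "\<not> contains_copy H (path_graph 3)" by (rule matching_exists)
  show ?thesis
  proof (rule st_num_union_K1_eqI[OF assms(1,3) H(1,2,3)])
    show "isolates_copies H Gs" using H iff[of H] by simp
    fix H' :: "nat ugraph"
    assume "simple_graph H'" "graph_order H' = n" "isolates_copies H' Gs"
    then show "graph_size H' \<le> n div 2" using matching_size[of H'] iff[of H'] by simp
  qed
qed

lemma P3_packing_exists:
  obtains H :: "nat ugraph" where "simple_graph H" "graph_order H = n" "graph_size H = 2 * n div 3"
    "isolates_copies H (path_graph 3)"
proof -
  \<comment> \<open>The numbers \<open>i + i div 2\<close> are those not congruent to 2 modulo 3, so the edges form the paths
    on \<open>3 * q, 3 * q + 1, 3 * q + 2\<close>, the last one possibly truncated.\<close>
  let ?s = "\<lambda>i::nat. i + i div 2"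
  let ?H = "({..<n}, (\<lambda>i. {?s i, Suc (?s i)}) ` {..<2 * n div 3})"
  have start: "\<exists>q. ?s i = 3 * q \<or> ?s i = 3 * q + 1" for i
    by (cases "even i") (auto elim!: evenE oddE)
  have in_range: "Suc (?s i) < n" if "i < 2 * n div 3" for i
    using that by linarith
  have s: "simple_graph ?H" using in_range by (auto simp: simple_graph_def Suc_lessD)
  have "inj_on (\<lambda>i::nat. {?s i, Suc (?s i)}) {..<2 * n div 3}"
  proof (rule inj_onI)
    fix i j :: nat assume "{?s i, Suc (?s i)} = {?s j, Suc (?s j)}"
    then have "?s i = ?s j" by (auto simp: doubleton_eq_iff)
    then show "i = j" using div_le_mono[of i j 2] div_le_mono[of j i 2] by linarith
  qed
  then have size: "graph_size ?H = 2 * n div 3" by (simp add: graph_size_def card_image)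
  have edge: "\<exists>q. x = 3 * q \<and> y = 3 * q + 1 \<or> y = 3 * q \<and> x = 3 * q + 1 \<or>
      x = 3 * q + 1 \<and> y = 3 * q + 2 \<or> y = 3 * q + 1 \<and> x = 3 * q + 2"
    if xy: "{x, y} \<in> edges ?H" for x y
  proof -
    obtain i where "{x, y} = {?s i, Suc (?s i)}" using xy by auto
    then have "x = ?s i \<and> y = Suc (?s i) \<or> y = ?s i \<and> x = Suc (?s i)"
      by (auto simp: doubleton_eq_iff)
    then show ?thesis using start[of i] by auto
  qed
  have "isolates_copies ?H (path_graph 3)"
    unfolding isolates_P3_iff[OF s]
  proof (intro allI impI)
    fix a b c assume *: "a \<noteq> c" "{a, b} \<in> edges ?H" "{b, c} \<in> edges ?H"
    obtain q where q: "a = 3 * q \<and> b = 3 * q + 1 \<or> b = 3 * q \<and> a = 3 * q + 1 \<or>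
      a = 3 * q + 1 \<and> b = 3 * q + 2 \<or> b = 3 * q + 1 \<and> a = 3 * q + 2"
      using edge[OF *(2)] by blast
    obtain q' where q': "b = 3 * q' \<and> c = 3 * q' + 1 \<or> c = 3 * q' \<and> b = 3 * q' + 1 \<or>
      b = 3 * q' + 1 \<and> c = 3 * q' + 2 \<or> c = 3 * q' + 1 \<and> b = 3 * q' + 2"
      using edge[OF *(3)] by blast
    have "q' = q" using q q' by (elim disjE conjE) linarith+
    then have abc: "b = 3 * q + 1" "a = 3 * q \<and> c = 3 * q + 2 \<or> a = 3 * q + 2 \<and> c = 3 * q"
      using q q' *(1) by auto
    show "{e \<in> edges ?H. e \<inter> {a, b, c} \<noteq> {}} = {{a, b}, {b, c}}"
    proof (intro equalityI subsetI)
      fix e assume "e \<in> {e \<in> edges ?H. e \<inter> {a, b, c} \<noteq> {}}"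
      then obtain x where e: "e \<in> edges ?H" and x: "x \<in> e" "x = a \<or> x = b \<or> x = c" by blast
      obtain y where y: "e = {x, y}"
        using edge_other_end[OF s e x(1)] by blast
      have xy: "{x, y} \<in> edges ?H" using e y by simp
      obtain r where r: "x = 3 * r \<and> y = 3 * r + 1 \<or> y = 3 * r \<and> x = 3 * r + 1 \<or>
        x = 3 * r + 1 \<and> y = 3 * r + 2 \<or> y = 3 * r + 1 \<and> x = 3 * r + 2"
        using edge[OF xy] by blast
      have x': "x = 3 * q \<or> x = 3 * q + 1 \<or> x = 3 * q + 2" using abc x(2) by blast
      have "r = q" using r x' by (elim disjE conjE) linarith+
      then have "x = b \<and> y = a \<or> x = b \<and> y = c \<or> x = a \<and> y = b \<or> x = c \<and> y = b"
        using r abc by auto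
      then show "e \<in> {{a, b}, {b, c}}" unfolding y by (auto simp: insert_commute)
    next
      fix e assume "e \<in> {{a, b}, {b, c}}"
      then show "e \<in> {e \<in> edges ?H. e \<inter> {a, b, c} \<noteq> {}}" using *(2,3) by blast
    qed
  qed
  then show ?thesis using that[OF s _ size] by (simp add: graph_order_def)
qed

lemma st_num_P3:
  assumes "simple_graph Gs" "Gs \<simeq>\<^sub>g path_graph 3" "n > graph_order Gs"
  shows "st_num n (Gs \<union>\<^sub>g complete_graph 1) = 2 * n div 3"
proof -
  obtain H :: "nat ugraph" where H: "simple_graph H" "graph_order H = n" "graph_size H = 2 * n div 3"
    "isolates_copies H (path_graph 3)" by (rule P3_packing_exists)
  show ?thesis
  proof (rule st_num_union_K1_eqI[OF assms(1,3) H(1,2,3)])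
    show "isolates_copies H Gs" using H(4) isolates_copies_iso[OF assms(1,2), of H] by simp
    fix H' :: "nat ugraph"
    assume "simple_graph H'" "graph_order H' = n" "isolates_copies H' Gs"
    then show "graph_size H' \<le> 2 * n div 3"
      using isolates_P3_size[of H'] isolates_copies_iso[OF assms(1,2), of H'] by simp
  qed
qed

lemma triangle_free_exists:
  obtains H :: "nat ugraph" where "simple_graph H" "graph_order H = n" "graph_size H = n\<^sup>2 div 4"
    "\<And>a b c. \<not> triangle H a b c"
proof -
  obtain B where B: "simple_graph ({..<n}, B)" "card B = n\<^sup>2 div 4" "\<And>a b c. \<not> triangle ({..<n}, B) a b c"
    using balanced_bipartite_exists[of "{..<n}"] by auto
  then show ?thesis using that[of "({..<n}, B)"] by (simp add: graph_order_def graph_size_def)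
qed

lemma isolates_K3_triangle_free:
  assumes "simple_graph H" "\<And>a b c. \<not> triangle H a b c"
  shows "isolates_copies H (complete_graph 3)"
  using assms unfolding isolates_K3_iff[OF assms(1)] by simp

lemma ex_num_K3: "ex_num n (complete_graph 3) = n\<^sup>2 div 4"
proof -
  obtain H :: "nat ugraph" where H: "simple_graph H" "graph_order H = n" "graph_size H = n\<^sup>2 div 4"
    "\<And>a b c. \<not> triangle H a b c" by (rule triangle_free_exists) blast
  show ?thesis
  proof (rule ex_num_eqI[OF H(1,2,3)])
    show "\<not> contains_copy H (complete_graph 3)" using contains_K3_iff[OF H(1)] H(4) by simp
    fix H' :: "nat ugraph"
    assume H': "simple_graph H'" "graph_order H' = n" "\<not> contains_copy H' (complete_graph 3)"
    then have "4 * graph_size H' \<le> n\<^sup>2"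
      using Mantel[OF H'(1)] contains_K3_iff[OF H'(1)] by simp
    then show "graph_size H' \<le> n\<^sup>2 div 4" by simp
  qed
qed

lemma ex_num_paw:
  assumes "n \<noteq> 3"
  shows "ex_num n (delete_edges (complete_graph 4) (path_graph 3)) = n\<^sup>2 div 4"
proof -
  obtain H :: "nat ugraph" where H: "simple_graph H" "graph_order H = n" "graph_size H = n\<^sup>2 div 4"
    "\<And>a b c. \<not> triangle H a b c" by (rule triangle_free_exists) blast
  show ?thesis
  proof (rule ex_num_eqI[OF H(1,2,3)])
    show "\<not> contains_copy H (delete_edges (complete_graph 4) (path_graph 3))"
      using contains_paw_iff[OF H(1)] isolates_K3_triangle_free[OF H(1,4)] by simp
    fix H' :: "nat ugraph"
    assume H': "simple_graph H'" "graph_order H' = n"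
      "\<not> contains_copy H' (delete_edges (complete_graph 4) (path_graph 3))"
    then show "graph_size H' \<le> n\<^sup>2 div 4"
      using isolates_K3_size[OF H'(1)] contains_paw_iff[OF H'(1)] assms by simp
  qed
qed

lemma st_num_K3:
  assumes "simple_graph Gs" "Gs \<simeq>\<^sub>g complete_graph 3" "n > graph_order Gs"
  shows "st_num n (Gs \<union>\<^sub>g complete_graph 1) = n\<^sup>2 div 4"
proof -
  obtain f where "bij_betw f (vertices Gs) (vertices (complete_graph 3))"
    using assms(2) unfolding graph_iso_def by blast
  then have n: "n \<noteq> 3"
    using assms(3) bij_betw_same_card by (fastforce simp: graph_order_def complete_graph_def)
  obtain H :: "nat ugraph" where H: "simple_graph H" "graph_order H = n" "graph_size H = n\<^sup>2 div 4"
    "\<And>a b c. \<not> triangle H a b c" by (rule triangle_free_exists) blast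
  show ?thesis
  proof (rule st_num_union_K1_eqI[OF assms(1,3) H(1,2,3)])
    show "isolates_copies H Gs"
      using isolates_K3_triangle_free[OF H(1,4)] isolates_copies_iso[OF assms(1,2), of H] by simp
    fix H' :: "nat ugraph"
    assume "simple_graph H'" "graph_order H' = n" "isolates_copies H' Gs"
    then show "graph_size H' \<le> n\<^sup>2 div 4"
      using isolates_K3_size[of H'] isolates_copies_iso[OF assms(1,2), of H'] n by simp
  qed
qed

section \<open>Replacing part of a host graph\<close>

text \<open>A connected graph cannot be embedded across a cut that no edge crosses.\<close>

lemma connected_embeds_one_side:
  assumes "connected_graph G" "embeds f G H" "\<And>e. e \<in> edges H \<Longrightarrow> e \<inter> U = {} \<or> e \<subseteq> U"
  shows "f ` vertices G \<subseteq> U \<or> f ` vertices G \<inter> U = {}"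
proof -
  have same_side: "f x \<in> U \<longleftrightarrow> f y \<in> U" if "(x, y) \<in> {(x, y). {x, y} \<in> edges G}\<^sup>*" for x y
    using that
  proof (induction rule: rtrancl_induct)
    case (step y z)
    then have "f ` {y, z} \<in> edges H" using assms(2) unfolding embeds_def by blast
    then have "{f y, f z} \<in> edges H" by simp
    with assms(3) have "f y \<in> U \<longleftrightarrow> f z \<in> U" by blast
    with step.IH show ?case by simp
  qed simp
  show ?thesis
    using assms(1) same_side unfolding connected_graph_def by blast
qed

lemma embeds_mono:
  assumes "embeds f G H" "vertices H \<subseteq> vertices H'" "edges H \<subseteq> edges H'"
  shows "embeds f G H'"
  using assms unfolding embeds_def by blast

lemma embeds_delete_vertices: "embeds f G (delete_vertices H U) \<Longrightarrow> embeds f G H"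
  by (erule embeds_mono) (auto simp: delete_vertices_def)

lemma delete_vertices_delete_vertices:
  "delete_vertices (delete_vertices H T) U = delete_vertices H (T \<union> U)"
  by (auto simp: delete_vertices_def)

lemma isolates_copies_delete_vertices:
  assumes "isolates_copies H G"
  shows "isolates_copies (delete_vertices H U) G"
  unfolding isolates_copies_def
proof (intro allI impI ballI)
  fix f e
  assume "embeds f G (delete_vertices H U)" "e \<in> edges (delete_vertices H U)" "e \<inter> f ` vertices G \<noteq> {}"
  then show "e \<in> (\<lambda>e. f ` e) ` edges G"
    using isolates_copiesD[OF assms embeds_delete_vertices] by (auto simp: delete_vertices_def)
qed

lemma size_embedded_image:
  assumes "simple_graph G" "inj_on f (vertices G)"
  shows "card ((\<lambda>e. f ` e) ` edges G) = graph_size G"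
proof -
  have "inj_on (\<lambda>e. f ` e) (edges G)"
    using inj_on_image_Pow[OF assms(2)] by (rule inj_on_subset) (use assms(1) in \<open>auto simp: simple_graph_def\<close>)
  then show ?thesis by (simp add: card_image graph_size_def)
qed

lemma edge_nonempty: "simple_graph H \<Longrightarrow> e \<in> edges H \<Longrightarrow> e \<noteq> {}"
  unfolding simple_graph_def by (metis card.empty zero_neq_numeral)

text \<open>
  All edges of \<open>H\<close> meeting \<open>U\<close> are removed and \<open>B\<close> is placed on \<open>U\<close> instead.
\<close>

lemma free_replacement:
  assumes G: "simple_graph G" "connected_graph G" and H: "simple_graph H" and U: "U \<subseteq> vertices H"
    and B: "simple_graph (U, B)" "\<not> contains_copy (U, B) G"
    and free: "\<not> contains_copy (delete_vertices H U) G"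
  obtains H' where "simple_graph H'" "vertices H' = vertices H" "\<not> contains_copy H' G"
    "edges H' = edges (delete_vertices H U) \<union> B"
    "graph_size H' = graph_size (delete_vertices H U) + card B"
proof -
  let ?D = "delete_vertices H U"
  let ?H = "(vertices H, edges ?D \<union> B)"
  have D: "simple_graph ?D" by (rule simple_graph_delete_vertices[OF H])
  have s: "simple_graph ?H"
    using H B(1) U unfolding simple_graph_def delete_vertices_def by auto
  have B2: "e \<subseteq> U" if "e \<in> B" for e using B(1) that by (auto simp: simple_graph_def)
  have nonempty: "e \<noteq> {}" if "e \<in> edges ?H" for e using edge_nonempty[OF s that] .
  have D2: "e \<inter> U = {}" if "e \<in> edges ?D" for e using that by (simp add: delete_vertices_def)
  have "\<not> contains_copy ?H G"
    unfolding contains_copy_iff[OF G(1) s]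
  proof
    assume "\<exists>f. embeds f G ?H"
    then obtain f where f: "embeds f G ?H" by blast
    have e_img: "f ` e \<subseteq> f ` vertices G" "f ` e \<in> edges ?H" if "e \<in> edges G" for e
      using that f G(1) by (auto simp: embeds_def simple_graph_def)
    have "e \<inter> U = {} \<or> e \<subseteq> U" if "e \<in> edges ?H" for e
      using that B2 D2 by (metis Un_iff snd_conv)
    from connected_embeds_one_side[OF G(2) f this] show False
    proof
      assume side: "f ` vertices G \<subseteq> U"
      have "f ` e \<in> B" if "e \<in> edges G" for e
      proof -
        have "f ` e \<subseteq> U" "f ` e \<noteq> {}"
          using order_trans[OF e_img(1)[OF that] side] nonempty[OF e_img(2)[OF that]] by simp_all
        then have "f ` e \<inter> U \<noteq> {}" by blast
        then have "f ` e \<notin> edges ?D" using D2 by metis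
        then show ?thesis using e_img(2)[OF that] by simp
      qed
      then have "embeds f G (U, B)" using f side by (simp add: embeds_def)
      then show False using B contains_copy_iff[OF G(1) B(1)] by blast
    next
      assume side: "f ` vertices G \<inter> U = {}"
      have "f ` e \<in> edges ?D" if "e \<in> edges G" for e
      proof -
        have "f ` e \<inter> U = {}" "f ` e \<noteq> {}"
          using e_img(1)[OF that] side nonempty[OF e_img(2)[OF that]] by blast+
        then have "\<not> f ` e \<subseteq> U" by blast
        then have "f ` e \<notin> B" using B2 by metis
        then show ?thesis using e_img(2)[OF that] by simp
      qed
      then have "embeds f G ?D" using f side by (auto simp: embeds_def delete_vertices_def)
      then show False using free contains_copy_iff[OF G(1) D] by blast
    qed
  qed
  moreover have "graph_size ?H = graph_size ?D + card B"
  proof -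
    have "edges ?D \<inter> B = {}" using B2 D2 nonempty by fastforce
    then show ?thesis
      using finite_edges[OF D] finite_edges[OF B(1)] by (simp add: graph_size_def card_Un_disjoint)
  qed
  ultimately show ?thesis using that[OF s] by simp
qed

text \<open>\<open>U\<close> is the union of all copies of \<open>G\<close>, and \<open>t\<close> is their number.\<close>

lemma isolated_copies_decomposition:
  assumes G: "simple_graph G" "vertices G \<noteq> {}" and "simple_graph H" "isolates_copies H G"
  shows "\<exists>U t. U \<subseteq> vertices H \<and> card U = t * graph_order G \<and>
    graph_size H = graph_size (delete_vertices H U) + t * graph_size G \<and>
    \<not> contains_copy (delete_vertices H U) G"
  using assms(3,4)
proof (induction "graph_order H" arbitrary: H rule: less_induct)
  case less
  show ?case
  proof (cases "contains_copy H G")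
    case False
    have "delete_vertices H {} = H" by (simp add: delete_vertices_def)
    with False show ?thesis by (intro exI[of _ "{}"] exI[of _ 0]) simp
  next
    case True
    then obtain f where f: "embeds f G H" using contains_copy_iff[OF G(1) less.prems(1)] by blast
    define T where "T = f ` vertices G"
    have inj: "inj_on f (vertices G)" and T: "T \<subseteq> vertices H"
      using f by (auto simp: embeds_def T_def)
    have cT: "card T = graph_order G" using inj by (simp add: T_def graph_order_def card_image)
    have finH: "finite (vertices H)" using less.prems(1) by (simp add: simple_graph_def)
    let ?H = "delete_vertices H T"
    have "{e \<in> edges H. e \<inter> T \<noteq> {}} = (\<lambda>e. f ` e) ` edges G"
    proof (intro equalityI subsetI)
      fix e assume "e \<in> {e \<in> edges H. e \<inter> T \<noteq> {}}"
      then show "e \<in> (\<lambda>e. f ` e) ` edges G"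
        using isolates_copiesD[OF less.prems(2) f] unfolding T_def by simp
    next
      fix e assume "e \<in> (\<lambda>e. f ` e) ` edges G"
      then obtain e' where e': "e' \<in> edges G" "e = f ` e'" by blast
      then have "e' \<noteq> {}" "e' \<subseteq> vertices G" "e \<in> edges H"
        using edge_nonempty[OF G(1)] G(1) f by (auto simp: simple_graph_def embeds_def)
      then show "e \<in> {e \<in> edges H. e \<inter> T \<noteq> {}}" using e'(2) by (auto simp: T_def)
    qed
    then have size1: "graph_size H = graph_size ?H + graph_size G"
      using size_delete_vertices[OF less.prems(1), of T] size_embedded_image[OF G(1) inj] by simp
    have "graph_order G > 0" using G by (auto simp: graph_order_def simple_graph_def card_gt_0_iff)
    then have "graph_order ?H < graph_order H" using order_delete_vertices[OF less.prems(1) T] cT by simp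
    from less.hyps[OF this simple_graph_delete_vertices[OF less.prems(1)]
        isolates_copies_delete_vertices[OF less.prems(2)]]
    obtain U t where U: "U \<subseteq> vertices ?H" "card U = t * graph_order G"
      "graph_size ?H = graph_size (delete_vertices ?H U) + t * graph_size G"
      "\<not> contains_copy (delete_vertices ?H U) G" by blast
    have "T \<inter> U = {}" "T \<union> U \<subseteq> vertices H" using U(1) T by (auto simp: delete_vertices_def)
    moreover from this have "card (T \<union> U) = Suc t * graph_order G"
      using cT U(2) finite_subset[OF _ finH, of T] finite_subset[OF _ finH, of U]
      by (simp add: card_Un_disjoint)
    ultimately show ?thesis
      using U(3,4) size1 by (intro exI[of _ "T \<union> U"] exI[of _ "Suc t"])
        (simp add: delete_vertices_delete_vertices)
  qed
qed

lemma free_graph_on_multiple: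
  assumes G: "simple_graph G" "connected_graph G"
    and blocks: "\<And>T :: 'b set. finite T \<Longrightarrow> card T = graph_order G \<Longrightarrow>
      \<exists>B. simple_graph (T, B) \<and> \<not> contains_copy (T, B) G \<and> graph_size G \<le> card B"
    and "finite (U :: 'b set)" "card U = t * graph_order G"
  shows "\<exists>B. simple_graph (U, B) \<and> \<not> contains_copy (U, B) G \<and> t * graph_size G \<le> card B"
  using assms(4,5)
proof (induction t arbitrary: U)
  case 0
  have s: "simple_graph (U, {})" using 0 by (simp add: simple_graph_def)
  have "vertices G \<noteq> {}" using G(2) by (simp add: connected_graph_def)
  with 0 have "\<not> contains_copy (U, {}) G"
    unfolding contains_copy_iff[OF G(1) s] by (auto simp: embeds_def)
  with s show ?case by auto
next
  case (Suc t)
  then obtain T where T: "T \<subseteq> U" "card T = graph_order G" "finite T"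
    by (metis obtain_subset_with_card_n le_add1 mult_Suc)
  then have "card (U - T) = t * graph_order G"
    using Suc.prems by (simp add: card_Diff_subset)
  from Suc.IH[OF _ this] Suc.prems(1) obtain B where B: "simple_graph (U - T, B)"
    "\<not> contains_copy (U - T, B) G" "t * graph_size G \<le> card B" by auto
  obtain B' where B': "simple_graph (T, B')" "\<not> contains_copy (T, B') G" "graph_size G \<le> card B'"
    using blocks[OF T(3,2)] by blast
  have s: "simple_graph (U, B)" using B(1) Suc.prems(1) by (auto simp: simple_graph_def)
  have D: "delete_vertices (U, B) T = (U - T, B)"
    using B(1) by (auto simp: delete_vertices_def simple_graph_def)
  have T': "T \<subseteq> vertices (U, B)" and free: "\<not> contains_copy (delete_vertices (U, B) T) G"
    using T(1) B(2) D by simp_all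
  obtain H' where H': "simple_graph H'" "vertices H' = vertices (U, B)" "\<not> contains_copy H' G"
    "graph_size H' = graph_size (delete_vertices (U, B) T) + card B'"
    by (rule free_replacement[OF G s T' B'(1,2) free])
  have "H' = (U, edges H')" using H'(2) by (simp add: prod_eq_iff)
  moreover have "Suc t * graph_size G \<le> card (edges H')"
    using H'(4) B(3) B'(3) unfolding D by (simp add: graph_size_def)
  ultimately show ?case using H'(1,3) by metis
qed

section \<open>Graphs that are nearly complete\<close>

text \<open>The set of vertices adjacent to \<open>v\<close>; its cardinality is the degree of \<open>v\<close>.\<close>

definition neighbours :: "'a ugraph \<Rightarrow> 'a \<Rightarrow> 'a set" where
  "neighbours H v = {u. {v, u} \<in> edges H}"

lemma finite_neighbours: "simple_graph H \<Longrightarrow> finite (neighbours H v)"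
  using simple_graph_edgeD(3) unfolding neighbours_def simple_graph_def
  by (metis (no_types, lifting) finite_subset mem_Collect_eq simple_graph_def simple_graph_edgeD(3) subsetI)

lemma edges_at_vertex:
  assumes "simple_graph H"
  shows "{e \<in> edges H. e \<inter> {v} \<noteq> {}} = (\<lambda>u. {v, u}) ` neighbours H v"
proof (intro equalityI subsetI)
  fix e assume "e \<in> {e \<in> edges H. e \<inter> {v} \<noteq> {}}"
  then have e: "e \<in> edges H" "v \<in> e" by auto
  obtain u where "e = {v, u}" using edge_other_end[OF assms e] by blast
  then show "e \<in> (\<lambda>u. {v, u}) ` neighbours H v" using e by (auto simp: neighbours_def)
qed (auto simp: neighbours_def)

lemma card_edges_at_vertex:
  assumes "simple_graph H"
  shows "card {e \<in> edges H. e \<inter> {v} \<noteq> {}} = card (neighbours H v)"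
  unfolding edges_at_vertex[OF assms]
  by (rule card_image) (auto simp: inj_on_def doubleton_eq_iff)

lemma card_pairs: "finite A \<Longrightarrow> card {e. e \<subseteq> A \<and> card e = 2} = card A choose 2"
  by (rule n_subsets)

lemma graph_size_le_choose:
  assumes "simple_graph H"
  shows "graph_size H \<le> graph_order H choose 2"
proof -
  have fin: "finite (vertices H)" using assms by (simp add: simple_graph_def)
  have "card (edges H) \<le> card {e. e \<subseteq> vertices H \<and> card e = 2}"
    using assms fin by (intro card_mono) (auto simp: simple_graph_def)
  then show ?thesis using card_pairs[OF fin] by (simp add: graph_size_def graph_order_def)
qed

lemma two_choose: "2 * (n choose 2) = n * (n - 1)"
proof -
  have "even (n * (n - 1))" by (cases n) auto
  then show ?thesis unfolding choose_two by simp
qed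

lemma clique_if_size_ge_choose:
  assumes "simple_graph H" "graph_order H choose 2 \<le> graph_size H"
    and "a \<in> vertices H" "b \<in> vertices H" "a \<noteq> b"
  shows "{a, b} \<in> edges H"
proof -
  have fin: "finite (vertices H)" using assms by (simp add: simple_graph_def)
  let ?P = "{e. e \<subseteq> vertices H \<and> card e = 2}"
  have "finite ?P" using fin by (auto intro: finite_subset[of _ "Pow (vertices H)"])
  moreover have "edges H \<subseteq> ?P" using assms(1) by (auto simp: simple_graph_def)
  moreover have "card ?P \<le> card (edges H)"
    using assms(2) card_pairs[OF fin] by (simp add: graph_size_def graph_order_def)
  ultimately have "edges H = ?P" by (rule card_seteq)
  then show ?thesis using assms(3-5) by auto
qed

text \<open>
  The graph consists of a complete graph on all vertices but one, and \<open>d\<close> edges at the remaining vertex.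
  A copy of \<open>G\<close> would have to use this vertex, whose degree is too small.
\<close>

lemma clique_plus_low_degree_vertex:
  assumes G: "simple_graph G" and deg: "\<And>v. v \<in> vertices G \<Longrightarrow> d < card (neighbours G v)"
    and T: "finite T" "card T = graph_order G" and d: "d < graph_order G"
  shows "\<exists>B. simple_graph (T, B) \<and> \<not> contains_copy (T, B) G \<and>
    card B = (graph_order G - 1 choose 2) + d"
proof -
  obtain x where x: "x \<in> T" using T d by fastforce
  obtain D where D: "D \<subseteq> T - {x}" "card D = d"
  proof -
    have "d \<le> card (T - {x})" using T d x by simp
    then show ?thesis using obtain_subset_with_card_n that by metis
  qed
  let ?P = "{e. e \<subseteq> T - {x} \<and> card e = 2}" and ?S = "(\<lambda>u. {x, u}) ` D"
  have s: "simple_graph (T, ?P \<union> ?S)"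
    using T x D unfolding simple_graph_def by (auto simp: card_insert_if)
  have "\<not> contains_copy (T, ?P \<union> ?S) G"
    unfolding contains_copy_iff[OF G s]
  proof
    assume "\<exists>f. embeds f G (T, ?P \<union> ?S)"
    then obtain f where f: "embeds f G (T, ?P \<union> ?S)" by blast
    then have inj: "inj_on f (vertices G)" and "f ` vertices G \<subseteq> T" by (auto simp: embeds_def)
    then have "f ` vertices G = T"
      using T by (intro card_subset_eq) (auto simp: card_image graph_order_def)
    then obtain v where v: "v \<in> vertices G" "f v = x" using x by auto
    have "f ` neighbours G v \<subseteq> D"
    proof
      fix y assume "y \<in> f ` neighbours G v"
      then obtain u where u: "y = f u" "{v, u} \<in> edges G" by (auto simp: neighbours_def)
      have "f ` {v, u} \<in> edges (T, ?P \<union> ?S)" using f u(2) unfolding embeds_def by blast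
      moreover have "{x, y} \<notin> ?P" by simp
      ultimately have "{x, y} \<in> ?S" using u(1) v(2) by simp
      then show "y \<in> D" using D(1) by (auto simp: doubleton_eq_iff)
    qed
    moreover have "finite D" using D T by (meson finite_Diff finite_subset)
    moreover have "inj_on f (neighbours G v)"
      using inj by (rule inj_on_subset) (auto simp: neighbours_def dest: simple_graph_edgeD[OF G])
    ultimately have "card (neighbours G v) \<le> d" using D(2) by (metis card_inj_on_le)
    then show False using deg[OF v(1)] by simp
  qed
  moreover have "card (?P \<union> ?S) = (graph_order G - 1 choose 2) + d"
  proof -
    have "finite ?P" "finite ?S" "?P \<inter> ?S = {}"
      using finite_edges[OF s] by auto
    moreover have "card ?P = (graph_order G - 1 choose 2)"
      using card_pairs[of "T - {x}"] T x by simp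
    moreover have "card ?S = d" using D by (subst card_image) (auto simp: inj_on_def doubleton_eq_iff)
    ultimately show ?thesis by (simp add: card_Un_disjoint)
  qed
  ultimately show ?thesis using s by blast
qed

lemma connected_neighbours_nonempty:
  assumes "simple_graph G" "connected_graph G" "graph_order G \<ge> 2" "v \<in> vertices G"
  shows "neighbours G v \<noteq> {}"
proof -
  have "vertices G \<noteq> {v}" using assms(3) by (auto simp: graph_order_def)
  then obtain u where u: "u \<in> vertices G" "u \<noteq> v" using assms(4) by blast
  then have "(v, u) \<in> {(x, y). {x, y} \<in> edges G}\<^sup>*"
    using assms(2,4) by (auto simp: connected_graph_def)
  then obtain y where "{v, y} \<in> edges G"
    using u(2) by (cases rule: converse_rtranclE) auto
  then show ?thesis by (auto simp: neighbours_def)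
qed

text \<open>A set of pairwise adjacent vertices, not required to be maximal.\<close>

definition clique :: "'a ugraph \<Rightarrow> 'a set \<Rightarrow> bool" where
  "clique H Q \<longleftrightarrow> Q \<subseteq> vertices H \<and> (\<forall>a\<in>Q. \<forall>b\<in>Q. a \<noteq> b \<longrightarrow> {a, b} \<in> edges H)"

lemma cliqueD: "clique H Q \<Longrightarrow> a \<in> Q \<Longrightarrow> b \<in> Q \<Longrightarrow> a \<noteq> b \<Longrightarrow> {a, b} \<in> edges H"
  by (simp add: clique_def)

lemma embeds_pairD:
  assumes "embeds f G H" "{a, b} \<in> edges G"
  shows "{f a, f b} \<in> edges H"
proof -
  have "f ` {a, b} \<in> edges H" using assms unfolding embeds_def by blast
  then show ?thesis by simp
qed

lemma clique_image:
  assumes "clique G Q" "embeds f G H"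
  shows "clique H (f ` Q)" "card (f ` Q) = card Q"
proof -
  have inj: "inj_on f Q" and Q: "Q \<subseteq> vertices G"
    using assms by (auto simp: clique_def embeds_def intro: inj_on_subset)
  then show "card (f ` Q) = card Q" by (simp add: card_image)
  have "{f a, f b} \<in> edges H" if "a \<in> Q" "b \<in> Q" "f a \<noteq> f b" for a b
    using that embeds_pairD[OF assms(2)] cliqueD[OF assms(1), of a b] by blast
  moreover have "f ` Q \<subseteq> vertices H" using assms(2) Q by (auto simp: embeds_def)
  ultimately show "clique H (f ` Q)" unfolding clique_def by blast
qed

lemma triangle_embeds:
  assumes "triangle G a b c" "embeds f G H"
  shows "triangle H (f a) (f b) (f c)"
  using assms(1) embeds_pairD[OF assms(2)] by (simp add: triangle_def)

text \<open>
  Let \<open>w\<close> be a vertex of minimum degree \<open>d\<close>, and compare \<open>G\<close> with the graph consisting of a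
  complete graph and one vertex of degree \<open>d - 1\<close>. Since \<open>G - w\<close> has at most \<open>s - 1 choose 2\<close> edges, where \<open>s\<close> is the order of \<open>G\<close>, the graph
  \<open>G\<close> can have more edges only if \<open>G - w\<close> is complete.
\<close>

lemma sparse_or_near_clique:
  fixes G :: "'a ugraph"
  assumes G: "simple_graph G" "connected_graph G" "graph_order G \<ge> 2"
  obtains (sparse) "\<And>T :: 'b set. finite T \<Longrightarrow> card T = graph_order G \<Longrightarrow>
      \<exists>B. simple_graph (T, B) \<and> \<not> contains_copy (T, B) G \<and> graph_size G \<le> card B"
  | (near_clique) w where "w \<in> vertices G" "clique G (vertices G - {w})"
      "graph_size G = (graph_order G - 1 choose 2) + card (neighbours G w)"
      "\<And>T :: 'b set. finite T \<Longrightarrow> card T = graph_order G \<Longrightarrow>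
        \<exists>B. simple_graph (T, B) \<and> \<not> contains_copy (T, B) G \<and>
          Suc (card B) = (graph_order G - 1 choose 2) + card (neighbours G w)"
proof -
  have fin: "finite (vertices G)" using G(1) by (simp add: simple_graph_def)
  have "vertices G \<noteq> {}" using G(2) by (simp add: connected_graph_def)
  then obtain w where w: "w \<in> vertices G"
      "\<And>v. v \<in> vertices G \<Longrightarrow> card (neighbours G w) \<le> card (neighbours G v)"
    using arg_min_if_finite[OF fin, of "\<lambda>v. card (neighbours G v)"]
    by (metis linorder_not_less)
  let ?d = "card (neighbours G w)" and ?s = "graph_order G"
  have d: "?d > 0"
    using connected_neighbours_nonempty[OF G w(1)] finite_neighbours[OF G(1)] by (simp add: card_gt_0_iff)
  have "neighbours G w \<subseteq> vertices G" using simple_graph_edgeD(3)[OF G(1)] by (auto simp: neighbours_def)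
  then have ds: "?d \<le> ?s" using fin by (auto simp: graph_order_def intro: card_mono)
  have block: "\<exists>B. simple_graph (T, B) \<and> \<not> contains_copy (T, B) G \<and>
      card B = (?s - 1 choose 2) + (?d - 1)" if "finite T" "card T = ?s" for T :: "'b set"
  proof (rule clique_plus_low_degree_vertex[OF G(1) _ that])
    show "?d - 1 < card (neighbours G v)" if "v \<in> vertices G" for v
      using w(2)[OF that] d by simp
    show "?d - 1 < ?s" using d ds by simp
  qed
  show ?thesis
  proof (cases "graph_size G \<le> (?s - 1 choose 2) + (?d - 1)")
    case True
    show ?thesis
    proof (rule sparse)
      fix T :: "'b set" assume "finite T" "card T = ?s"
      from block[OF this] True
      show "\<exists>B. simple_graph (T, B) \<and> \<not> contains_copy (T, B) G \<and> graph_size G \<le> card B" by auto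
    qed
  next
    case False
    let ?G = "delete_vertices G {w}"
    have sG: "simple_graph ?G" by (rule simple_graph_delete_vertices[OF G(1)])
    have order: "graph_order ?G = ?s - 1" using order_delete_vertices[OF G(1), of "{w}"] w(1) by simp
    have size: "graph_size G = graph_size ?G + ?d"
      using size_delete_vertices[OF G(1), of "{w}"] card_edges_at_vertex[OF G(1), of w] by simp
    have large: "graph_order ?G choose 2 \<le> graph_size ?G" using False size d order by simp
    show ?thesis
    proof (rule near_clique)
      show "w \<in> vertices G" by (rule w(1))
      show "clique G (vertices G - {w})"
        using clique_if_size_ge_choose[OF sG large]
        by (auto simp: clique_def delete_vertices_def)
      show "graph_size G = (?s - 1 choose 2) + ?d"
        using size large graph_size_le_choose[OF sG] order by simp
      fix T :: "'b set" assume "finite T" "card T = ?s"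
      from block[OF this] d
      show "\<exists>B. simple_graph (T, B) \<and> \<not> contains_copy (T, B) G \<and>
          Suc (card B) = (?s - 1 choose 2) + ?d" by fastforce
    qed
  qed
qed

text \<open>
  If deleting \<open>w\<close> leaves a complete graph on at least three vertices and \<open>w\<close> has degree at least 2,
  then every edge lies in a triangle.
\<close>

lemma near_clique_common_neighbour:
  assumes G: "simple_graph G" "graph_order G \<ge> 4" "clique G (vertices G - {w})"
    and deg: "card (neighbours G w) \<ge> 2" and pq: "{p, q} \<in> edges G"
  shows "\<exists>r. {p, r} \<in> edges G \<and> {q, r} \<in> edges G"
proof -
  have fin: "finite (vertices G)" using G(1) by (simp add: simple_graph_def)
  have via_w: "\<exists>r. {w, r} \<in> edges G \<and> {q, r} \<in> edges G" if "{w, q} \<in> edges G" for q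
  proof -
    have "\<not> neighbours G w \<subseteq> {q}"
      using deg card_mono[of "{q}" "neighbours G w"] by auto
    then obtain r where r: "{w, r} \<in> edges G" "r \<noteq> q" by (auto simp: neighbours_def)
    have "q \<in> vertices G - {w}" "r \<in> vertices G - {w}"
      using simple_graph_edgeD[OF G(1) that] simple_graph_edgeD[OF G(1) r(1)] by auto
    then have "{q, r} \<in> edges G" using cliqueD[OF G(3)] r(2) by metis
    with r show ?thesis by blast
  qed
  show ?thesis
  proof (cases "p = w \<or> q = w")
    case True
    then show ?thesis
    proof
      assume "p = w" then show ?thesis using via_w pq by simp
    next
      assume "q = w"
      moreover from this have "{w, p} \<in> edges G" using pq by (simp add: insert_commute)
      ultimately show ?thesis using via_w[of p] by blast
    qed
  next
    case False
    have "card {w, p, q} \<le> 3" by (simp add: card_insert_if)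
    then have "\<not> vertices G \<subseteq> {w, p, q}"
      using G(2) card_mono[of "{w, p, q}" "vertices G"] unfolding graph_order_def by fastforce
    then obtain r where "r \<in> vertices G" "r \<notin> {w, p, q}" by blast
    then have "{p, r} \<in> edges G" "{q, r} \<in> edges G"
      using cliqueD[OF G(3)] False simple_graph_edgeD[OF G(1) pq] by auto
    then show ?thesis by blast
  qed
qed

text \<open>
  Joining the two sides of a cut by a single edge creates no copy of \<open>G\<close> if each edge of \<open>G\<close> lies in
  a triangle.
\<close>

lemma bridge_free:
  assumes G: "simple_graph G" and tri: "\<And>p q. {p, q} \<in> edges G \<Longrightarrow> \<exists>r. {p, r} \<in> edges G \<and> {q, r} \<in> edges G"
    and H: "simple_graph H" "\<not> contains_copy H G"
    and sides: "\<And>e. e \<in> edges H \<Longrightarrow> e \<inter> T = {} \<or> e \<subseteq> T"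
    and xy: "x \<in> T" "y \<notin> T" "x \<in> vertices H" "y \<in> vertices H"
  shows "simple_graph (vertices H, insert {x, y} (edges H))"
    "\<not> contains_copy (vertices H, insert {x, y} (edges H)) G"
    "graph_size (vertices H, insert {x, y} (edges H)) = Suc (graph_size H)"
proof -
  let ?H = "(vertices H, insert {x, y} (edges H))"
  have "x \<noteq> y" using xy by blast
  then show s: "simple_graph ?H" using H(1) xy by (auto simp: simple_graph_def)
  have "{x, y} \<notin> edges H" using sides[of "{x, y}"] xy by blast
  then show "graph_size ?H = Suc (graph_size H)"
    using finite_edges[OF H(1)] by (simp add: graph_size_def)
  show "\<not> contains_copy ?H G"
    unfolding contains_copy_iff[OF G s]
  proof
    assume "\<exists>f. embeds f G ?H"
    then obtain f where f: "embeds f G ?H" by blast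
    have inj: "inj_on f (vertices G)" using f by (simp add: embeds_def)
    have img: "{f a, f b} \<in> insert {x, y} (edges H)" if "{a, b} \<in> edges G" for a b
      using embeds_pairD[OF f that] by simp
    have "f ` e \<in> edges H" if e: "e \<in> edges G" for e
    proof (rule ccontr)
      assume "f ` e \<notin> edges H"
      moreover have "f ` e \<in> edges ?H" using f e unfolding embeds_def by blast
      ultimately have fe: "f ` e = {x, y}" by simp
      then obtain p where p: "p \<in> e" "f p = x" by (metis imageE insertI1)
      obtain q where q: "e = {p, q}" using edge_other_end[OF G e p(1)] by blast
      have fq: "f q = y" using fe p(2) q \<open>x \<noteq> y\<close> by (auto simp: doubleton_eq_iff)
      obtain r where r: "{p, r} \<in> edges G" "{q, r} \<in> edges G" using tri e q by blast
      have "p \<noteq> r" "q \<noteq> r" "p \<in> vertices G" "q \<in> vertices G" "r \<in> vertices G"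
        using simple_graph_edgeD[OF G r(1)] simple_graph_edgeD[OF G r(2)] by auto
      then have ne: "f r \<noteq> x" "f r \<noteq> y" using inj p(2) fq by (auto simp: inj_on_def)
      \<comment> \<open>The third vertex of the triangle would lie on both sides of the bridge.\<close>
      have "{x, f r} \<in> edges H" "{y, f r} \<in> edges H"
        using img[OF r(1)] img[OF r(2)] p(2) fq ne by (auto simp: doubleton_eq_iff)
      then show False using sides[of "{x, f r}"] sides[of "{y, f r}"] xy by blast
    qed
    then have "embeds f G H" using f by (simp add: embeds_def)
    then show False using H contains_copy_iff[OF G H(1)] by blast
  qed
qed

text \<open>
  Here \<open>G\<close> is a complete graph with a pendant edge at \<open>z\<close>. An edge leaving a clique \<open>Q\<close> of the right size
  would complete it to a copy of \<open>G\<close>.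
\<close>

lemma pendant_clique_closed:
  assumes G: "simple_graph G" "clique G (vertices G - {w})" "neighbours G w = {z}" "w \<in> vertices G"
    and H: "simple_graph H" "\<not> contains_copy H G"
    and Q: "clique H Q" "card Q = graph_order G - 1" "finite Q"
    and e: "e \<in> edges H" "e \<inter> Q \<noteq> {}"
  shows "e \<subseteq> Q"
proof (rule ccontr)
  assume "\<not> e \<subseteq> Q"
  obtain c where c: "c \<in> e" "c \<in> Q" using e(2) by blast
  obtain d where d: "e = {c, d}" using edge_other_end[OF H(1) e(1) c(1)] by blast
  have dQ: "d \<notin> Q" using \<open>\<not> e \<subseteq> Q\<close> c d by blast
  have dV: "d \<in> vertices H" using simple_graph_edgeD[OF H(1)] e(1) d by blast
  have fin: "finite (vertices G)" using G(1) by (simp add: simple_graph_def)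
  have wz: "{w, z} \<in> edges G" using G(3) by (auto simp: neighbours_def)
  then have z: "z \<in> vertices G" "z \<noteq> w" using simple_graph_edgeD[OF G(1) wz] by auto
  have "card (vertices G - {w} - {z}) = card (Q - {c})"
    using Q(2,3) c(2) z G(4) fin by (simp add: graph_order_def)
  then obtain g where g: "bij_betw g (vertices G - {w} - {z}) (Q - {c})"
    using finite_same_card_bij fin Q(3) by (metis finite_Diff)
  define f where "f = (\<lambda>v. if v = w then d else if v = z then c else g v)"
  have gQ: "g v \<in> Q" "g v \<noteq> c" if "v \<in> vertices G" "v \<noteq> w" "v \<noteq> z" for v
    using g that unfolding bij_betw_def by auto
  have ginj: "u = v" if "g u = g v" "u \<in> vertices G - {w} - {z}" "v \<in> vertices G - {w} - {z}" for u v
    using g that unfolding bij_betw_def inj_on_def by blast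
  have fQ: "f v \<in> Q" if "v \<in> vertices G" "v \<noteq> w" for v
    using gQ[of v] that c(2) by (simp add: f_def)
  have "inj_on f (vertices G)"
  proof (rule inj_onI)
    fix u v assume uv: "u \<in> vertices G" "v \<in> vertices G" "f u = f v"
    show "u = v"
    proof (cases "u = w \<or> v = w")
      case True
      then show ?thesis using fQ[of u] fQ[of v] uv dQ by (auto simp: f_def split: if_splits)
    next
      case False
      then show ?thesis using gQ[of u] gQ[of v] ginj[of u v] uv by (auto simp: f_def split: if_splits)
    qed
  qed
  moreover have "f ` vertices G \<subseteq> vertices H"
  proof
    fix y assume "y \<in> f ` vertices G"
    then obtain v where "y = f v" "v \<in> vertices G" by blast
    then show "y \<in> vertices H" using fQ[of v] dV Q(1) unfolding clique_def by (cases "v = w") (auto simp: f_def)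
  qed
  moreover have "f ` e' \<in> edges H" if e': "e' \<in> edges G" for e'
  proof (cases "w \<in> e'")
    case True
    obtain u where u: "e' = {w, u}" using edge_other_end[OF G(1) e' True] by blast
    then have "u = z" using e' G(3) by (auto simp: neighbours_def)
    then have "f ` e' = {d, c}" using u z(2) by (simp add: f_def insert_commute)
    then show ?thesis using e(1) d by (simp add: insert_commute)
  next
    case False
    obtain a b where ab: "e' = {a, b}" "a \<noteq> b" "a \<in> vertices G" "b \<in> vertices G"
      using simple_graph_edgeE[OF G(1) e'] by blast
    then have "f a \<noteq> f b" using \<open>inj_on f (vertices G)\<close> by (auto simp: inj_on_def)
    then have "{f a, f b} \<in> edges H" using cliqueD[OF Q(1)] fQ ab False by auto
    then show ?thesis using ab by simp
  qed
  ultimately have "embeds f G H" by (simp add: embeds_def)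
  then show False using H contains_copy_iff[OF G(1) H(1)] by blast
qed

text \<open>
  The new vertices in \<open>T\<close> become pairwise non-adjacent twins of \<open>v\<close>, so a clique contains at most one
  of them, and not together with \<open>v\<close>.
\<close>

lemma join_twins_free:
  assumes H: "simple_graph H" and U: "T \<inter> vertices H = {}" "finite T" and v: "v \<in> vertices H"
    and k: "\<forall>Q. clique H Q \<longrightarrow> card Q \<noteq> k"
  defines "H' \<equiv> (T \<union> vertices H, edges H \<union> (\<lambda>(x, u). {x, u}) ` (T \<times> neighbours H v))"
  shows "simple_graph H'" "\<And>Q. clique H' Q \<Longrightarrow> card Q \<noteq> k"
    "graph_size H' = graph_size H + card T * card (neighbours H v)"
proof -
  let ?N = "neighbours H v"
  let ?J = "(\<lambda>(x, u). {x, u}) ` (T \<times> ?N)"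
  have NV: "?N \<subseteq> vertices H" using simple_graph_edgeD(3)[OF H] by (auto simp: neighbours_def)
  have HV: "e \<subseteq> vertices H" if "e \<in> edges H" for e using H that by (simp add: simple_graph_def)
  show s: "simple_graph H'"
    using H U NV unfolding simple_graph_def H'_def by (auto simp: card_insert_if)
  have "edges H \<inter> ?J = {}" using HV U(1) by fastforce
  moreover have "inj_on (\<lambda>(x, u). {x, u}) (T \<times> ?N)"
    using U(1) NV by (auto simp: inj_on_def doubleton_eq_iff)
  then have "card ?J = card T * card ?N"
    by (simp add: card_image card_cartesian_product)
  ultimately show "graph_size H' = graph_size H + card T * card ?N"
    using finite_edges[OF H] finite_edges[OF s] unfolding H'_def graph_size_def
    by (simp add: card_Un_disjoint)
  have old: "{a, b} \<in> edges H" if "{a, b} \<in> edges H'" "a \<notin> T" "b \<notin> T" for a b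
    using that by (auto simp: H'_def doubleton_eq_iff)
  have new: "u \<in> ?N" if "{x, u} \<in> edges H'" "x \<in> T" for x u
  proof -
    have "{x, u} \<notin> edges H" using HV[of "{x, u}"] that(2) U(1) by blast
    then have "{x, u} \<in> ?J" using that by (simp add: H'_def)
    then show ?thesis using that(2) NV U(1) by (auto simp: doubleton_eq_iff)
  qed
  fix Q assume Q: "clique H' Q"
  show "card Q \<noteq> k"
  proof (cases "Q \<inter> T = {}")
    case True
    then have "{a, b} \<in> edges H" if "a \<in> Q" "b \<in> Q" "a \<noteq> b" for a b
      using old[OF cliqueD[OF Q that]] that by blast
    moreover have "Q \<subseteq> vertices H" using Q True by (auto simp: clique_def H'_def)
    ultimately have "clique H Q" by (simp add: clique_def)
    then show ?thesis using k by blast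
  next
    case False
    then obtain x where x: "x \<in> Q" "x \<in> T" by blast
    have QN: "Q - {x} \<subseteq> ?N" using new x cliqueD[OF Q x(1)] by blast
    \<comment> \<open>Replacing the twin \<open>x\<close> by \<open>v\<close> turns \<open>Q\<close> into a clique of \<open>H\<close>.\<close>
    have vN: "v \<notin> ?N" using simple_graph_edgeD(1)[OF H, of v v] by (auto simp: neighbours_def)
    have "{a, b} \<in> edges H" if "a \<in> Q - {x}" "b \<in> Q - {x}" "a \<noteq> b" for a b
      using old cliqueD[OF Q, of a b] that QN NV U(1) by blast
    moreover have "{v, a} \<in> edges H" "{a, v} \<in> edges H" if "a \<in> Q - {x}" for a
      using QN that by (auto simp: neighbours_def insert_commute)
    ultimately have "clique H (insert v (Q - {x}))"
      using QN NV v unfolding clique_def by auto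
    then have "card (insert v (Q - {x})) \<noteq> k" using k by blast
    moreover have "finite Q" using Q s unfolding clique_def simple_graph_def by (meson finite_subset)
    then have "card (insert v (Q - {x})) = card Q"
      using x(1) vN QN by (metis card.insert card_Suc_Diff1 finite_Diff subset_iff)
    ultimately show ?thesis by simp
  qed
qed

lemma graph_size_le_degree_bound:
  assumes "simple_graph H" "\<And>v. v \<in> vertices H \<Longrightarrow> card (neighbours H v) \<le> d"
  shows "graph_size H \<le> graph_order H * d"
proof -
  have fin: "finite (vertices H)" using assms by (simp add: simple_graph_def)
  have "edges H \<subseteq> (\<Union>v\<in>vertices H. (\<lambda>u. {v, u}) ` neighbours H v)"
  proof
    fix e assume e: "e \<in> edges H"
    then obtain a b where "e = {a, b}" "a \<in> vertices H" using simple_graph_edgeE[OF assms(1)] by metis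
    with e show "e \<in> (\<Union>v\<in>vertices H. (\<lambda>u. {v, u}) ` neighbours H v)"
      by (auto simp: neighbours_def)
  qed
  then have "graph_size H \<le> card (\<Union>v\<in>vertices H. (\<lambda>u. {v, u}) ` neighbours H v)"
    using fin finite_neighbours[OF assms(1)] unfolding graph_size_def by (intro card_mono) auto
  also have "\<dots> \<le> (\<Sum>v\<in>vertices H. card ((\<lambda>u. {v, u}) ` neighbours H v))"
    by (rule card_UN_le[OF fin])
  also have "\<dots> \<le> (\<Sum>v\<in>vertices H. d)"
    by (intro sum_mono order_trans[OF card_image_le[OF finite_neighbours[OF assms(1)]] assms(2)])
  finally show ?thesis by (simp add: graph_order_def)
qed


section \<open>Eventual equality of the two extremal numbers\<close>

text \<open>
  The bound on the order of \<open>H\<close> leaves room for a bridge, and it makes the last case, where all degrees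
  outside the isolated copy are small, fall below the size of a balanced bipartite graph.
\<close>

lemma free_graph_at_least_as_large:
  fixes G :: "'a ugraph" and H :: "'b ugraph"
  assumes G: "simple_graph G" "connected_graph G" "graph_order G \<ge> 4"
    and H: "simple_graph H" "isolates_copies H G" "graph_order H \<ge> 8 * graph_order G"
  shows "\<exists>H' :: 'b ugraph. simple_graph H' \<and> graph_order H' = graph_order H \<and> \<not> contains_copy H' G \<and>
    graph_size H \<le> graph_size H'"
proof -
  let ?s = "graph_order G" and ?e = "graph_size G"
  have finH: "finite (vertices H)" using H(1) by (simp add: simple_graph_def)
  have "vertices G \<noteq> {}" using G(2) by (simp add: connected_graph_def)
  from isolated_copies_decomposition[OF G(1) this H(1,2)]
  obtain U t where U: "U \<subseteq> vertices H" "card U = t * ?s"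
    "graph_size H = graph_size (delete_vertices H U) + t * ?e"
    and free: "\<not> contains_copy (delete_vertices H U) G" by blast
  have finU: "finite U" using U(1) finH by (rule finite_subset)
  have swap: ?thesis
    if W: "W \<subseteq> vertices H" "\<not> contains_copy (delete_vertices H W) G"
      and B: "simple_graph (W, B)" "\<not> contains_copy (W, B) G"
      and size: "graph_size H \<le> graph_size (delete_vertices H W) + card B" for W B
  proof -
    obtain H' where H': "simple_graph H'" "vertices H' = vertices H" "\<not> contains_copy H' G"
      "graph_size H' = graph_size (delete_vertices H W) + card B"
      by (rule free_replacement[OF G(1,2) H(1) W(1) B W(2)])
    with size show ?thesis by (intro exI[of _ H']) (simp add: graph_order_def)
  qed
  have "graph_order G \<ge> 2" using G(3) by simp
  from G(1,2) this show ?thesis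
  proof (cases rule: sparse_or_near_clique[where 'b = 'b])
    case sparse
    from free_graph_on_multiple[OF G(1,2) sparse finU U(2)]
    obtain B where "simple_graph (U, B)" "\<not> contains_copy (U, B) G" "t * ?e \<le> card B" by blast
    then show ?thesis using swap[OF U(1) free] U(3) by simp
  next
    case (near_clique w)
    let ?d = "card (neighbours G w)" and ?c = "graph_order G - 1 choose 2"
    have finG: "finite (vertices G)" using G(1) by (simp add: simple_graph_def)
    have d: "?d > 0"
      using connected_neighbours_nonempty[OF G(1,2) _ near_clique(1)] G(3) finite_neighbours[OF G(1)]
      by (simp add: card_gt_0_iff)
    have e2: "2 * ?e \<le> ?s * (?s - 1)"
      using graph_size_le_choose[OF G(1)] two_choose[of ?s] by linarith
    have e2': "2 * ?e \<le> ?s * ?s"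
      using order_trans[OF e2 mult_le_mono2[of "?s - 1" ?s ?s]] by simp
    have c2: "2 * ?c = (?s - 1) * (?s - 2)" using two_choose[of "?s - 1"] by (simp add: numeral_2_eq_2)
    have cardQ: "card (vertices G - {w}) = ?s - 1"
      using near_clique(1) finG by (simp add: graph_order_def)
    have "3 \<le> card (vertices G - {w})" using cardQ G(3) by simp
    then obtain P where P: "P \<subseteq> vertices G - {w}" "card P = 3"
      by (rule obtain_subset_with_card_n)
    then obtain p q r where "P = {p, q, r}" "p \<noteq> q" "p \<noteq> r" "q \<noteq> r" by (auto simp: card_3_iff)
    then have tri: "triangle G p q r"
      using P(1) cliqueD[OF near_clique(2)] by (simp add: triangle_def)
    have bipartite: "\<exists>B. simple_graph (W, B) \<and> \<not> contains_copy (W, B) G \<and> card B = (card W)\<^sup>2 div 4"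
      if finW: "finite W" for W :: "'b set"
    proof -
      obtain B where B: "simple_graph (W, B)" "card B = (card W)\<^sup>2 div 4"
        "\<And>a b c. \<not> triangle (W, B) a b c"
        using balanced_bipartite_exists[OF finW] by metis
      have "\<not> contains_copy (W, B) G"
        unfolding contains_copy_iff[OF G(1) B(1)] using triangle_embeds[OF tri] B(3) by blast
      with B show ?thesis by blast
    qed
    show ?thesis
    proof (cases "t = 1")
      case False
      \<comment> \<open>Two or more copies, of average degree at most \<open>s - 1\<close>, are outweighed by a bipartite graph of
        average degree about \<open>t * s / 2\<close>.\<close>
      have "4 * (t * ?e) \<le> (t * ?s)\<^sup>2"
      proof (cases "t = 0")
        case True
        then show ?thesis by simp
      next
        case False
        with \<open>t \<noteq> 1\<close> have t2: "2 \<le> t" by simp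
        have "4 * (t * ?e) = 2 * t * (2 * ?e)" by simp
        also have "\<dots> \<le> 2 * t * (?s * ?s)" using e2' by (rule mult_le_mono2)
        also have "\<dots> \<le> t * t * (?s * ?s)" using t2 by (intro mult_right_mono) auto
        finally show ?thesis by (simp add: power2_eq_square algebra_simps)
      qed
      then have "t * ?e \<le> (card U)\<^sup>2 div 4" using U(2) by simp
      moreover obtain B where "simple_graph (U, B)" "\<not> contains_copy (U, B) G"
        "card B = (card U)\<^sup>2 div 4"
        using bipartite[OF finU] by blast
      ultimately show ?thesis using swap[OF U(1) free] U(3) by simp
    next
      case True
      let ?D = "delete_vertices H U"
      have sD: "simple_graph ?D" by (rule simple_graph_delete_vertices[OF H(1)])
      have cU: "card U = ?s" and size: "graph_size H = graph_size ?D + ?e" using U True by simp_all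
      have order: "graph_order H = graph_order ?D + ?s"
        using order_delete_vertices[OF H(1) U(1)] cU by simp
      show ?thesis
      proof (cases "?d = 1")
        case False
        with d have d2: "?d \<ge> 2" by simp
        \<comment> \<open>\<open>B\<close> has one edge less than \<open>G\<close>; the bridge \<open>{x, y}\<close> makes up for it.\<close>
        obtain B where B: "simple_graph (U, B)" "\<not> contains_copy (U, B) G" "Suc (card B) = ?c + ?d"
          using near_clique(4)[OF finU cU] by blast
        obtain H' where H': "simple_graph H'" "vertices H' = vertices H" "\<not> contains_copy H' G"
          "edges H' = edges ?D \<union> B" "graph_size H' = graph_size ?D + card B"
          by (rule free_replacement[OF G(1,2) H(1) U(1) B(1,2) free])
        have "U \<noteq> {}" using cU G(3) by auto
        then obtain x where x: "x \<in> U" by blast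
        have "U \<noteq> vertices H" using order cU H(3) G(3) by (auto simp: graph_order_def)
        then obtain y where y: "y \<in> vertices H" "y \<notin> U" using U(1) by blast
        have sides: "e \<inter> U = {} \<or> e \<subseteq> U" if "e \<in> edges H'" for e
          using that B(1) unfolding H'(4) simple_graph_def delete_vertices_def by auto
        have x': "x \<in> vertices H'" and y': "y \<in> vertices H'" using x y U(1) H'(2) by auto
        note bridge = bridge_free[OF G(1) near_clique_common_neighbour[OF G(1,3) near_clique(2) d2]
            H'(1,3) sides x y(2) x' y']
        have "graph_size H \<le> graph_size (vertices H', insert {x, y} (edges H'))"
          using bridge(3) H'(5) B(3) size near_clique(3) by simp
        then show ?thesis
          using bridge(1,2) H'(2) by (intro exI[of _ "(vertices H', insert {x, y} (edges H'))"])
            (simp add: graph_order_def)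
      next
        case d1: True
        then obtain z where z: "neighbours G w = {z}" by (auto simp: card_1_singleton_iff)
        have e: "?e = ?c + 1" using near_clique(3) d1 by simp
        show ?thesis
        proof (cases "\<exists>Q. clique ?D Q \<and> card Q = ?s - 1")
          case True
          then obtain Q where Q: "clique ?D Q" "card Q = ?s - 1" by blast
          have QV: "Q \<subseteq> vertices H" "Q \<inter> U = {}"
            using Q(1) by (auto simp: clique_def delete_vertices_def)
          have finQ: "finite Q" using QV(1) finH by (rule finite_subset)
          have "{e \<in> edges ?D. e \<inter> Q \<noteq> {}} \<subseteq> {e. e \<subseteq> Q \<and> card e = 2}"
            using pendant_clique_closed[OF G(1) near_clique(2) z near_clique(1) sD free Q finQ] sD
            by (auto simp: simple_graph_def)
          then have "card {e \<in> edges ?D. e \<inter> Q \<noteq> {}} \<le> ?c"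
            using card_mono[of "{e. e \<subseteq> Q \<and> card e = 2}"] card_pairs[OF finQ] Q(2) finQ
            by (simp add: finite_subset[of _ "Pow Q"] subset_iff)
          then have size2: "graph_size H \<le> graph_size (delete_vertices H (U \<union> Q)) + (?c + ?e)"
            using size_delete_vertices[OF sD, of Q] size by (simp add: delete_vertices_delete_vertices)
          have W: "U \<union> Q \<subseteq> vertices H" "finite (U \<union> Q)" using U(1) QV(1) finU finQ by auto
          have cW: "card (U \<union> Q) = 2 * ?s - 1"
            using card_Un_disjoint[OF finU finQ] QV(2) cU Q(2) G(3) by (simp add: Int_commute)
          have "embeds f G (delete_vertices H (U \<union> Q)) \<Longrightarrow> embeds f G ?D" for f
            by (erule embeds_mono) (auto simp: delete_vertices_def)
          then have freeW: "\<not> contains_copy (delete_vertices H (U \<union> Q)) G"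
            using free contains_copy_iff[OF G(1) sD]
              contains_copy_iff[OF G(1) simple_graph_delete_vertices[OF H(1)]] by blast
          obtain m where m: "?s = m + 4" using G(3) by (metis add.commute le_Suc_ex)
          have "4 * (?c + ?e) = 4 * (2 * ?c) + 4" using e by simp
          also have "\<dots> = 4 * ((m + 3) * (m + 2)) + 4" unfolding c2 unfolding m by simp
          also have "\<dots> \<le> (2 * ?s - 1)\<^sup>2" unfolding m by (simp add: power2_eq_square algebra_simps)
          finally have "?c + ?e \<le> (card (U \<union> Q))\<^sup>2 div 4" unfolding cW by simp
          moreover obtain B where "simple_graph (U \<union> Q, B)" "\<not> contains_copy (U \<union> Q, B) G"
            "card B = (card (U \<union> Q))\<^sup>2 div 4"
            using bipartite[OF W(2)] by blast
          ultimately show ?thesis using swap[OF W(1) freeW] size2 by simp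
        next
          case no_clique: False
          then have k: "\<forall>Q. clique ?D Q \<longrightarrow> card Q \<noteq> ?s - 1" by blast
          show ?thesis
          proof (cases "\<exists>v\<in>vertices ?D. ?s \<le> card (neighbours ?D v)")
            case True
            then obtain v where v: "v \<in> vertices ?D" "?s \<le> card (neighbours ?D v)" by blast
            have UD: "U \<inter> vertices ?D = {}" "U \<union> vertices ?D = vertices H"
              using U(1) by (auto simp: delete_vertices_def)
            define H' where "H' = (U \<union> vertices ?D, edges ?D \<union> (\<lambda>(x, u). {x, u}) ` (U \<times> neighbours ?D v))"
            note join = join_twins_free[OF sD UD(1) finU v(1) k, folded H'_def]
            have "\<not> contains_copy H' G"
              unfolding contains_copy_iff[OF G(1) join(1)]
            proof
              assume "\<exists>f. embeds f G H'"
              then obtain f where "embeds f G H'" by blast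
              from clique_image[OF near_clique(2) this] show False
                using join(2) cardQ by simp
            qed
            moreover have "?e \<le> card U * card (neighbours ?D v)"
            proof -
              have "?e \<le> ?s * ?s" using e2' by simp
              also have "\<dots> \<le> ?s * card (neighbours ?D v)" using v(2) by simp
              finally show ?thesis by (simp add: cU)
            qed
            then have "graph_size H \<le> graph_size H'" using join(3) size by simp
            moreover have "graph_order H' = graph_order H"
              using UD(2) by (simp add: H'_def graph_order_def)
            ultimately show ?thesis using join(1) by blast
          next
            case False
            then have "graph_size ?D \<le> graph_order ?D * ?s"
              by (intro graph_size_le_degree_bound[OF sD]) auto
            then have "2 * graph_size H \<le> 2 * (graph_order ?D * ?s) + ?s * ?s"
              using size e2' by linarith
            also have "\<dots> \<le> 2 * (graph_order H * ?s)" unfolding order by (simp add: algebra_simps)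
            finally have "4 * graph_size H \<le> 8 * (graph_order H * ?s)" by linarith
            also have "\<dots> = graph_order H * (8 * ?s)" by simp
            also have "\<dots> \<le> (graph_order H)\<^sup>2"
              unfolding power2_eq_square using H(3) by (intro mult_left_mono) auto
            finally have "graph_size H \<le> (card (vertices H))\<^sup>2 div 4" by (simp add: graph_order_def)
            moreover obtain B where "simple_graph (vertices H, B)"
              "\<not> contains_copy (vertices H, B) G" "card B = (card (vertices H))\<^sup>2 div 4"
              using bipartite[OF finH] by blast
            ultimately show ?thesis
              by (intro exI[of _ "(vertices H, B)"]) (simp add: graph_order_def graph_size_def)
          qed
        qed
      qed
    qed
  qed
qed

lemma st_num_eq_ex_num:
  assumes G: "simple_graph G" "connected_graph G" "graph_order G \<ge> 4" and n: "n \<ge> 8 * graph_order G"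
  shows "st_num n (G \<union>\<^sub>g complete_graph 1) = ex_num n G"
proof -
  let ?E = "({..<n}, {}) :: nat ugraph"
  have sE: "simple_graph ?E" by (simp add: simple_graph_def)
  have "isolates_copies ?E G" by (simp add: isolates_copies_def)
  from free_graph_at_least_as_large[OF G sE this] n
  obtain H0 :: "nat ugraph" where "simple_graph H0" "graph_order H0 = n" "\<not> contains_copy H0 G"
    by (auto simp: graph_order_def)
  then obtain H :: "nat ugraph" where H: "simple_graph H" "graph_order H = n" "\<not> contains_copy H G"
    "graph_size H = ex_num n G"
    and max: "\<And>H' :: nat ugraph. simple_graph H' \<Longrightarrow> graph_order H' = n \<Longrightarrow> \<not> contains_copy H' G \<Longrightarrow>
       graph_size H' \<le> ex_num n G"
    by (rule ex_num_attained) blast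
  show ?thesis
  proof (rule st_num_union_K1_eqI[OF G(1) _ H(1,2,4)])
    show "n > graph_order G" using n G(3) by simp
    show "isolates_copies H G"
      using H(3) contains_copy_iff[OF G(1) H(1)] by (simp add: isolates_copies_def)
    fix H' :: "nat ugraph"
    assume H': "simple_graph H'" "graph_order H' = n" "isolates_copies H' G"
    then obtain H'' :: "nat ugraph" where "simple_graph H''" "graph_order H'' = n"
      "\<not> contains_copy H'' G" "graph_size H' \<le> graph_size H''"
      using free_graph_at_least_as_large[OF G H'(1,3)] n by auto
    then show "graph_size H' \<le> ex_num n G" using max[of H''] by simp
  qed
qed

theorem theorem9:
  fixes Gs :: "'a ugraph" and G :: "('a + nat) ugraph"
  assumes "simple_graph Gs" and "connected_graph Gs"
    and "G = Gs \<union>\<^sub>g complete_graph 1"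
  shows "(graph_order Gs \<ge> 4 \<longrightarrow>
           (\<exists>n0. \<forall>n\<ge>n0. n \<ge> graph_order G \<longrightarrow> st_num n G = ex_num n Gs)) \<and>
         (Gs \<simeq>\<^sub>g complete_graph 2 \<longrightarrow>
           (\<forall>n\<ge>graph_order G. st_num n G = ex_num n (path_graph 3) \<and>
              ex_num n (path_graph 3) = n div 2)) \<and>
         (Gs \<simeq>\<^sub>g path_graph 3 \<longrightarrow>
           (\<forall>n\<ge>graph_order G. st_num n G = 2 * n div 3)) \<and>
         (Gs \<simeq>\<^sub>g complete_graph 3 \<longrightarrow>
           (\<forall>n\<ge>graph_order G.
              st_num n G = ex_num n (delete_edges (complete_graph 4) (path_graph 3)) \<and>
              ex_num n (delete_edges (complete_graph 4) (path_graph 3)) =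
                ex_num n (complete_graph 3) \<and>
              ex_num n (complete_graph 3) = n\<^sup>2 div 4))"
proof (intro conjI impI)
  have order: "graph_order G = Suc (graph_order Gs)"
    unfolding assms(3) by (rule graph_order_union_K1[OF assms(1)])
  show "\<exists>n0. \<forall>n\<ge>n0. n \<ge> graph_order G \<longrightarrow> st_num n G = ex_num n Gs" if "graph_order Gs \<ge> 4"
    unfolding assms(3) using st_num_eq_ex_num[OF assms(1,2) that] by blast
  show "\<forall>n\<ge>graph_order G. st_num n G = ex_num n (path_graph 3) \<and> ex_num n (path_graph 3) = n div 2"
    if "Gs \<simeq>\<^sub>g complete_graph 2"
    using st_num_K2[OF assms(1) that] order by (simp add: ex_num_P3 assms(3))
  show "\<forall>n\<ge>graph_order G. st_num n G = 2 * n div 3" if "Gs \<simeq>\<^sub>g path_graph 3"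
    using st_num_P3[OF assms(1) that] order by (simp add: assms(3))
  show "\<forall>n\<ge>graph_order G.
      st_num n G = ex_num n (delete_edges (complete_graph 4) (path_graph 3)) \<and>
      ex_num n (delete_edges (complete_graph 4) (path_graph 3)) = ex_num n (complete_graph 3) \<and>
      ex_num n (complete_graph 3) = n\<^sup>2 div 4" if K3: "Gs \<simeq>\<^sub>g complete_graph 3"
  proof (intro allI impI)
    fix n assume n: "n \<ge> graph_order G"
    obtain f where "bij_betw f (vertices Gs) (vertices (complete_graph 3))"
      using K3 unfolding graph_iso_def by blast
    then have "graph_order Gs = 3"
      using bij_betw_same_card by (fastforce simp: graph_order_def complete_graph_def)
    then have "n \<noteq> 3" using n order by simp
    then show "st_num n G = ex_num n (delete_edges (complete_graph 4) (path_graph 3)) \<and>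
      ex_num n (delete_edges (complete_graph 4) (path_graph 3)) = ex_num n (complete_graph 3) \<and>
      ex_num n (complete_graph 3) = n\<^sup>2 div 4"
      using st_num_K3[OF assms(1) K3, of n] n order
      by (simp add: ex_num_K3 ex_num_paw assms(3))
  qed
qed

end
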